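(* Let $X$ and $X'$ be finite disjoint subsets of $\mathfrak{X}$. Assume that a projection operator $P\in\mathrm{Gr}(\mathcal{K},\Gamma)$ is $(X,X')$-regular. Then the conditional measure $M^{P}_{X,X'}:=(M^{P})_{X,X'}$ satisfies $$M^{P}_{X,X'}=M^{P_{X,X'}}$$ (in particular $M^{P}_{X,X'}$ is defined, i.e. $M^{P}(C(X,X'))>0$). In particular, $M^{P}_{X,X'}$ is a Pfaffian point process associated with a projection operator.
   Context: $\mathfrak{X}$ is a countable set. For $\mathfrak{Y}\subset\mathfrak{X}$, $\Omega(\mathfrak{Y})=\{0,1\}^{\mathfrak{Y}}$ with product topology and Borel $\sigma$-algebra; elements are identified with subsets of $\mathfrak{Y}$; $\Omega=\Omega(\mathfrak{X})$. $e_{x}\in\ell^{2}(\mathfrak{X})$ is $e_{x}(y)=\delta_{x,y}$; inner products are linear in the second argument; $J$ is the antilinear conjugation fixing each $e_{x}$; $\mathcal{K}=\ell^{2}(\mathfrak{X})\oplus\ell^{2}(\mathfrak{X})$, $\Gamma=\begin{pmatrix}0 & J\\ J & 0\end{pmatrix}$. For $A\subset\mathfrak{X}$: $\mathcal{K}_{A}^{+}$ (resp. $\mathcal{K}_{A}^{-}$) is the closed span of $\{(e_{x},0):x\in A\}$ (resp. $\{(0,e_{x}):x\in A\}$), $\mathcal{K}_{A}=\mathcal{K}_{A}^{+}\oplus\mathcal{K}_{A}^{-}\cong\ell^{2}(A)\oplus\ell^{2}(A)$, $\Gamma_{A}=\Gamma|_{\mathcal{K}_{A}}$. $\mathrm{Gr}(\mathcal{K}_{A},\Gamma_{A})$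 is the set of orthogonal projections $P$ on $\mathcal{K}_{A}$ with $\Gamma_{A}P\Gamma_{A}=1-P$; $\mathrm{Gr}(\mathcal{K},\Gamma)$ is the case $A=\mathfrak{X}$. Pfaffian point process of a projection: for $P=\begin{pmatrix}P_{11}&P_{12}\\ P_{21}&P_{22}\end{pmatrix}\in\mathrm{Gr}(\mathcal{K}_{A},\Gamma_{A})$ put $\mathbb{K}_{P}(x,y)=\begin{pmatrix}(e_{x},P_{21}e_{y}) & (e_{x},P_{22}e_{y})\\ (e_{x},(P_{11}-1)e_{y}) & (e_{x},P_{12}e_{y})\end{pmatrix}$, $x,y\in A$. $M^{P}$ is the unique probability measure on $\Omega(A)$ (it exists) with $M^{P}(\{\omega:\omega(x_{1})=\cdots=\omega(x_{n})=1\})=\mathrm{Pf}[\mathbb{K}_{P}(x_{i},x_{j})]_{1\le i,j\le n}$ for all $n$ and distinct $x_{1},\dots,x_{n}\in A$, where $[\mathbb{K}_{P}(x_{i},x_{j})]$ is the antisymmetric $2n\times 2n$ matrix with $2\times2$ blocks $\mathbb{K}_{P}(x_{i},x_{j})$. It is called the Pfaffian point process associated with $P$. Conditional measures: $C(X,X')=\{\omega\in\Omega:X\subset\omega,\ X'\cap\omega=\varnothing\}$, and $F_{X,X'}:C(X,X')\to\Omega(\mathfrak{X}\setminus(X\sqcup X'))$, $\omega\mapsto\omega\setminus X$. For a probability measure $M$ on $\Omega$ with $M(C(X,X'))>0$, $M_{X,X'}$ is the push-forward under $F_{X,X'}$ of $M|_{C(X,X')}/M(C(X,X'))$. Reduced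 projection: $P_{X,X'}$ is the orthogonal projection in $\mathcal{K}_{\mathfrak{X}\setminus(X\sqcup X')}$ onto $\big(P\mathcal{K}+(\mathcal{K}_{X}^{+}\oplus\mathcal{K}_{X'}^{-})\big)\cap\mathcal{K}_{\mathfrak{X}\setminus(X\sqcup X')}$; it belongs to $\mathrm{Gr}(\mathcal{K}_{\mathfrak{X}\setminus(X\sqcup X')},\Gamma_{\mathfrak{X}\setminus(X\sqcup X')})$. Regularity: $P$ is $(X,X')$-regular if $P\mathcal{K}\cap(\mathcal{K}_{X}^{+}\oplus\mathcal{K}_{X'}^{-})=\{0\}$. *)

theory Defs
  imports
    "HOL-Probability.Probability"
    "HOL-Library.Function_Algebras"
    "HOL-Combinatorics.Permutations"
begin

section \<open>The Hilbert spaces\<close>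

text \<open>
  A vector of \<open>\<ell>\<^sup>2(A)\<close> is a function on the whole type that vanishes off \<open>A\<close>. With this
  extension by zero, \<open>\<ell>\<^sup>2(A)\<close> is a subset of \<open>\<ell>\<^sup>2(B)\<close> whenever \<open>A\<close> is a subset of \<open>B\<close>, and
  likewise for the doubled spaces.
\<close>

type_synonym 'a dvec = "('a \<Rightarrow> complex) \<times> ('a \<Rightarrow> complex)"

definition ell2 :: "'a set \<Rightarrow> ('a \<Rightarrow> complex) set" where
  "ell2 A = {f. (\<forall>x. x \<notin> A \<longrightarrow> f x = 0) \<and> (\<lambda>x. (cmod (f x))\<^sup>2) summable_on UNIV}"

definition ell2_inner :: "('a \<Rightarrow> complex) \<Rightarrow> ('a \<Rightarrow> complex) \<Rightarrow> complex" where
  "ell2_inner f g = (\<Sum>\<^sub>\<infinity>x. cnj (f x) * g x)"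

definition unit_vec :: "'a \<Rightarrow> 'a \<Rightarrow> complex" where
  "unit_vec x = (\<lambda>y. if x = y then 1 else 0)"

definition conj_J :: "('a \<Rightarrow> complex) \<Rightarrow> ('a \<Rightarrow> complex)" where
  "conj_J f = (\<lambda>x. cnj (f x))"

definition KK :: "'a set \<Rightarrow> 'a dvec set" where
  "KK A = ell2 A \<times> ell2 A"

definition KK_inner :: "'a dvec \<Rightarrow> 'a dvec \<Rightarrow> complex" where
  "KK_inner u v = ell2_inner (fst u) (fst v) + ell2_inner (snd u) (snd v)"

definition KK_norm :: "'a dvec \<Rightarrow> real" where
  "KK_norm v = sqrt (Re (KK_inner v v))"

definition KK_scale :: "complex \<Rightarrow> 'a dvec \<Rightarrow> 'a dvec" where
  "KK_scale c v = ((\<lambda>x. c * fst v x), (\<lambda>x. c * snd v x))"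

definition Gamma :: "'a dvec \<Rightarrow> 'a dvec" where
  "Gamma v = (conj_J (snd v), conj_J (fst v))"

global_interpretation KK: vector_space KK_scale
  defines KK_span = KK.span
  by unfold_locales
     (auto simp: KK_scale_def fun_eq_iff prod_eq_iff algebra_simps)

definition KK_closed_span :: "'a dvec set \<Rightarrow> 'a dvec set" where
  "KK_closed_span S = {v \<in> KK UNIV. \<forall>\<epsilon>>0. \<exists>u\<in>KK_span S. KK_norm (v - u) < \<epsilon>}"

definition KK_plus :: "'a set \<Rightarrow> 'a dvec set" where
  "KK_plus A = KK_closed_span {(unit_vec x, 0) |x. x \<in> A}"

definition KK_minus :: "'a set \<Rightarrow> 'a dvec set" where
  "KK_minus A = KK_closed_span {(0, unit_vec x) |x. x \<in> A}"


section \<open>Projections\<close>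

text \<open>
  An operator on \<open>KK A\<close> is a function on the ambient type of which only the restriction to
  \<open>KK A\<close> matters. Linear symmetric idempotents are automatically bounded.
\<close>

definition is_orth_projection_on :: "'a set \<Rightarrow> ('a dvec \<Rightarrow> 'a dvec) \<Rightarrow> bool" where
  "is_orth_projection_on A P \<longleftrightarrow>
     (\<forall>v\<in>KK A. P v \<in> KK A) \<and>
     (\<forall>u\<in>KK A. \<forall>v\<in>KK A. P (u + v) = P u + P v) \<and>
     (\<forall>c. \<forall>v\<in>KK A. P (KK_scale c v) = KK_scale c (P v)) \<and>
     (\<forall>v\<in>KK A. P (P v) = P v) \<and>
     (\<forall>u\<in>KK A. \<forall>v\<in>KK A. KK_inner (P u) v = KK_inner u (P v))"

definition Gr :: "'a set \<Rightarrow> ('a dvec \<Rightarrow> 'a dvec) set" where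
  "Gr A = {P. is_orth_projection_on A P \<and> (\<forall>v\<in>KK A. Gamma (P (Gamma v)) = v - P v)}"

definition orth_projection_onto :: "'a dvec set \<Rightarrow> 'a dvec \<Rightarrow> 'a dvec" where
  "orth_projection_onto V v = (THE w. w \<in> V \<and> (\<forall>u\<in>V. KK_inner u (v - w) = 0))"

text \<open>In the next two definitions \<open>+\<close> between sets is the elementwise (Minkowski) sum.\<close>

definition reduced_projection ::
  "'a set \<Rightarrow> ('a dvec \<Rightarrow> 'a dvec) \<Rightarrow> 'a set \<Rightarrow> 'a set \<Rightarrow> 'a dvec \<Rightarrow> 'a dvec" where
  "reduced_projection \<XX> P X X' =
     orth_projection_onto ((P ` KK \<XX> + (KK_plus X + KK_minus X')) \<inter> KK (\<XX> - (X \<union> X')))"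

definition regular ::
  "'a set \<Rightarrow> ('a dvec \<Rightarrow> 'a dvec) \<Rightarrow> 'a set \<Rightarrow> 'a set \<Rightarrow> bool" where
  "regular \<XX> P X X' \<longleftrightarrow> P ` KK \<XX> \<inter> (KK_plus X + KK_minus X') = {0}"


section \<open>Point configurations\<close>

text \<open>
  Configurations on \<open>A\<close> are subsets of \<open>A\<close>; the topology is that of \<open>{0,1}\<^sup>A\<close>, transported
  along the indicator map, and the measurable sets are its Borel sets.
\<close>

definition Omega_topology :: "'a set \<Rightarrow> 'a set topology" where
  "Omega_topology A =
     pullback_topology (Pow A) (\<lambda>\<omega>. \<lambda>x\<in>A. x \<in> \<omega>)
       (product_topology (\<lambda>_. discrete_topology (UNIV :: bool set)) A)"

definition Omega :: "'a set \<Rightarrow> 'a set measure" where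
  "Omega A = sigma (Pow A) {U. openin (Omega_topology A) U}"

definition cylinder :: "'a set \<Rightarrow> 'a set \<Rightarrow> 'a set \<Rightarrow> 'a set set" where
  "cylinder \<XX> X X' = {\<omega> \<in> Pow \<XX>. X \<subseteq> \<omega> \<and> X' \<inter> \<omega> = {}}"

definition conditional_measure ::
  "'a set \<Rightarrow> 'a set measure \<Rightarrow> 'a set \<Rightarrow> 'a set \<Rightarrow> 'a set measure" where
  "conditional_measure \<XX> M X X' =
     distr
       (scale_measure (inverse (emeasure M (cylinder \<XX> X X')))
          (restrict_space M (cylinder \<XX> X X')))
       (Omega (\<XX> - (X \<union> X')))
       (\<lambda>\<omega>. \<omega> - X)"


section \<open>Pfaffian point processes\<close>

text \<open>The Pfaffian of an antisymmetric matrix of size \<open>2 * n\<close>, indexed from \<open>0\<close>.\<close>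

definition pfaffian :: "nat \<Rightarrow> (nat \<Rightarrow> nat \<Rightarrow> complex) \<Rightarrow> complex" where
  "pfaffian n A =
     (\<Sum>\<sigma> | \<sigma> permutes {..<2 * n}.
        of_int (sign \<sigma>) * (\<Prod>i<n. A (\<sigma> (2 * i)) (\<sigma> (2 * i + 1)))) / (2 ^ n * fact n)"

text \<open>
  The \<open>2 \<times> 2\<close> block of the kernel at \<open>(x, y)\<close>, as a list of rows. The blocks of \<open>P\<close> are read
  off from \<open>P (f, 0) = (P\<^sub>1\<^sub>1 f, P\<^sub>2\<^sub>1 f)\<close> and \<open>P (0, f) = (P\<^sub>1\<^sub>2 f, P\<^sub>2\<^sub>2 f)\<close>.
\<close>

definition kernel_block :: "('a dvec \<Rightarrow> 'a dvec) \<Rightarrow> 'a \<Rightarrow> 'a \<Rightarrow> complex list list" where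
  "kernel_block P x y =
     [[ell2_inner (unit_vec x) (snd (P (unit_vec y, 0))),
       ell2_inner (unit_vec x) (snd (P (0, unit_vec y)))],
      [ell2_inner (unit_vec x) (fst (P (unit_vec y, 0)) - unit_vec y),
       ell2_inner (unit_vec x) (fst (P (0, unit_vec y)))]]"

definition kernel_matrix :: "('a dvec \<Rightarrow> 'a dvec) \<Rightarrow> 'a list \<Rightarrow> nat \<Rightarrow> nat \<Rightarrow> complex" where
  "kernel_matrix P xs i j =
     kernel_block P (xs ! (i div 2)) (xs ! (j div 2)) ! (i mod 2) ! (j mod 2)"

definition is_pfaffian_process ::
  "'a set \<Rightarrow> ('a dvec \<Rightarrow> 'a dvec) \<Rightarrow> 'a set measure \<Rightarrow> bool" where
  "is_pfaffian_process A P M \<longleftrightarrow>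
     prob_space M \<and> space M = Pow A \<and> sets M = sets (Omega A) \<and>
     (\<forall>xs. distinct xs \<and> set xs \<subseteq> A \<longrightarrow>
        complex_of_real (measure M {\<omega> \<in> Pow A. \<forall>x\<in>set xs. x \<in> \<omega>})
          = pfaffian (length xs) (kernel_matrix P xs))"

definition pfaffian_process ::
  "'a set \<Rightarrow> ('a dvec \<Rightarrow> 'a dvec) \<Rightarrow> 'a set measure" where
  "pfaffian_process A P = (THE M. is_pfaffian_process A P M)"

end

theory Submission
  imports Defs
begin

text \<open>
  The theorem is conditioning on the state of a single point, iterated.

  Fix a point \<open>x\<close> and a state \<open>b\<close>, occupied or vacant. Let \<open>u\<close> be the unit vector at \<open>x\<close> in
  \<open>\<K>\<^sup>+\<close> if \<open>x\<close> is to be occupied and in \<open>\<K>\<^sup>-\<close> if it is to be vacant, and put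
  \<open>d = \<langle>\<Gamma>u, P\<Gamma>u\<rangle> = \<parallel>(1 - P)u\<parallel>\<^sup>2\<close>; this is the probability of the event, and it vanishes exactly if
  \<open>u\<close> lies in the range of \<open>P\<close>, that is, if regularity fails at \<open>x\<close>. When \<open>d \<noteq> 0\<close>, linear algebra
  shows that the orthogonal projection onto \<open>(P\<K> + \<complex>u) \<inter> \<K>\<^bsub>A - {x}\<^esub>\<close> differs from \<open>P\<close> by an
  explicit operator of rank at most two (\<open>reduce_at\<close>, \<open>reduce_at_Gr\<close>, \<open>reduce_at_range\<close>). Its entries are
  those of a Schur complement: for an occupied point the kernel of the reduced projection is the
  Schur complement of the kernel of \<open>P\<close> with respect to the \<open>2 \<times> 2\<close> block at \<open>x\<close>, whose upper
  right entry is \<open>d\<close>; for a vacant point the same holds once that entry is lowered by \<open>1\<close>, which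
  turns it into \<open>-d\<close>. The identity \<open>Pf M = M\<^sub>0\<^sub>1 Pf (Schur complement)\<close> (\<open>pfaffian_pivot\<close>),
  together with the fact that lowering the entry subtracts the Pfaffian without the point
  (\<open>pfaffian_lower_first_pair\<close>), says that the weight of a cylinder that prescribes the state of
  \<open>x\<close> is \<open>d\<close> times the weight of the remaining cylinder for the reduced projection
  (\<open>cyl_weight_one_point\<close>). This stays true for \<open>d = 0\<close>, because then a row of the matrix vanishes.

  By induction all cylinder weights, defined from the Pfaffians by inclusion and exclusion, are
  nonnegative. Kolmogorov's theorem therefore yields the process of \<open>P\<close>, and it is unique
  because the events \<open>F \<subseteq> \<omega>\<close> form a generator that is closed under intersection. Running the
  same induction through the points of \<open>X\<close> and \<open>X'\<close> (\<open>iterated_reduction\<close>) keeps regularity, so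
  that every factor \<open>d\<close> is positive, and the successive ranges add up to the subspace that defines
  \<open>P\<^bsub>X,X'\<^esub>\<close>. Hence the cylinder \<open>C(X, X')\<close> has positive probability, and dividing by it leaves
  the correlations of the reduced projection.
\<close>

section \<open>Pfaffians\<close>

abbreviation transposition :: "'a \<Rightarrow> 'a \<Rightarrow> 'a \<Rightarrow> 'a" where
  "transposition \<equiv> Transposition.transpose"

definition pf_term :: "nat \<Rightarrow> (nat \<Rightarrow> nat \<Rightarrow> complex) \<Rightarrow> (nat \<Rightarrow> nat) \<Rightarrow> complex" where
  "pf_term n A \<sigma> = of_int (sign \<sigma>) * (\<Prod>i<n. A (\<sigma> (2 * i)) (\<sigma> (2 * i + 1)))"

definition antisym_upto :: "nat \<Rightarrow> (nat \<Rightarrow> nat \<Rightarrow> complex) \<Rightarrow> bool" where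
  "antisym_upto n A \<longleftrightarrow> (\<forall>i<n. \<forall>j<n. A j i = - A i j)"

lemma antisym_uptoD: "antisym_upto n A \<Longrightarrow> i < n \<Longrightarrow> j < n \<Longrightarrow> A j i = - A i j"
  unfolding antisym_upto_def by blast

lemma pfaffian_eq_sum_pf_term:
  "pfaffian n A = (\<Sum>\<sigma> | \<sigma> permutes {..<2 * n}. pf_term n A \<sigma>) / (2 ^ n * fact n)"
  by (simp add: pfaffian_def pf_term_def)

text \<open>
  The two indices of a pair are images of different arguments under a permutation, so the
  diagonal never enters. Several matrices below are therefore described off the diagonal only.
\<close>

lemma pf_term_cong:
  assumes "\<sigma> permutes {..<2 * n}"
    and "\<And>i j. i < 2 * n \<Longrightarrow> j < 2 * n \<Longrightarrow> i \<noteq> j \<Longrightarrow> A i j = B i j"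
  shows "pf_term n A \<sigma> = pf_term n B \<sigma>"
proof -
  have "A (\<sigma> (2 * i)) (\<sigma> (2 * i + 1)) = B (\<sigma> (2 * i)) (\<sigma> (2 * i + 1))" if "i < n" for i
  proof (rule assms(2))
    show "\<sigma> (2 * i) < 2 * n" "\<sigma> (2 * i + 1) < 2 * n"
      using permutes_in_image[OF assms(1)] that by auto
    show "\<sigma> (2 * i) \<noteq> \<sigma> (2 * i + 1)"
      by (simp add: inj_eq[OF permutes_inj[OF assms(1)]])
  qed
  then show ?thesis
    by (simp add: pf_term_def)
qed

lemma pfaffian_cong:
  assumes "\<And>i j. i < 2 * n \<Longrightarrow> j < 2 * n \<Longrightarrow> i \<noteq> j \<Longrightarrow> A i j = B i j"
  shows "pfaffian n A = pfaffian n B"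
proof -
  have "pf_term n A \<sigma> = pf_term n B \<sigma>" if "\<sigma> permutes {..<2 * n}" for \<sigma>
    by (rule pf_term_cong[OF that assms])
  then show ?thesis
    unfolding pfaffian_eq_sum_pf_term by simp
qed

lemma pfaffian_relabel:
  assumes "\<rho> permutes {..<2 * n}"
  shows "pfaffian n (\<lambda>i j. A (\<rho> i) (\<rho> j)) = of_int (sign \<rho>) * pfaffian n A"
proof -
  have "of_int (sign \<rho>) * pf_term n A (\<rho> \<circ> \<sigma>) = pf_term n (\<lambda>i j. A (\<rho> i) (\<rho> j)) \<sigma>"
    if "\<sigma> permutes {..<2 * n}" for \<sigma>
  proof -
    have "sign (\<rho> \<circ> \<sigma>) = sign \<rho> * sign \<sigma>"
      using assms that by (intro sign_compose) (auto simp: permutation_permutes)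
    then have "of_int (sign \<rho>) * of_int (sign (\<rho> \<circ> \<sigma>)) = (of_int (sign \<sigma>) :: complex)"
      by (metis of_int_mult sign_left_idempotent)
    then show ?thesis
      by (simp add: pf_term_def mult.assoc[symmetric])
  qed
  then have "(\<Sum>\<sigma> | \<sigma> permutes {..<2 * n}. pf_term n (\<lambda>i j. A (\<rho> i) (\<rho> j)) \<sigma>)
      = of_int (sign \<rho>) * (\<Sum>\<sigma> | \<sigma> permutes {..<2 * n}. pf_term n A (\<rho> \<circ> \<sigma>))"
    by (simp add: sum_distrib_left)
  also have "(\<Sum>\<sigma> | \<sigma> permutes {..<2 * n}. pf_term n A (\<rho> \<circ> \<sigma>))
      = (\<Sum>\<sigma> | \<sigma> permutes {..<2 * n}. pf_term n A \<sigma>)"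
    by (rule sum.reindex_bij_witness[where i = "\<lambda>\<sigma>. inv \<rho> \<circ> \<sigma>" and j = "\<lambda>\<sigma>. \<rho> \<circ> \<sigma>"])
      (auto simp: o_assoc permutes_inv_o[OF assms] intro!: permutes_compose permutes_inv assms)
  finally show ?thesis
    by (simp add: pfaffian_eq_sum_pf_term)
qed

text \<open>
  Exchanging the two indices leaves the matrix alone but changes the sign of the Pfaffian.
\<close>

lemma pfaffian_two_equal_rows:
  assumes "p < 2 * n" "q < 2 * n" "p \<noteq> q"
    and row: "\<And>k. k < 2 * n \<Longrightarrow> A p k = A q k" and col: "\<And>k. k < 2 * n \<Longrightarrow> A k p = A k q"
  shows "pfaffian n A = 0"
proof -
  have perm: "transposition p q permutes {..<2 * n}"
    using assms by (intro permutes_swap_id) auto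
  have "pfaffian n A = pfaffian n (\<lambda>i j. A (transposition p q i) (transposition p q j))"
    using assms by (intro pfaffian_cong) (auto simp: Transposition.transpose_def)
  also have "\<dots> = - pfaffian n A"
    by (simp only: pfaffian_relabel[OF perm]) (use \<open>p \<noteq> q\<close> in \<open>simp add: sign_swap_id\<close>)
  finally show ?thesis
    by simp
qed

text \<open>
  In the product for a given permutation the index \<open>q\<close> occurs in exactly one factor, so the
  Pfaffian is linear in row and column \<open>q\<close> taken together.
\<close>

lemma pfaffian_linear_row:
  assumes q: "q < 2 * n"
    and off: "\<And>i j. i < 2 * n \<Longrightarrow> j < 2 * n \<Longrightarrow> i \<noteq> q \<Longrightarrow> j \<noteq> q \<Longrightarrow> A i j = B i j \<and> A i j = C i j"
    and row: "\<And>j. j < 2 * n \<Longrightarrow> j \<noteq> q \<Longrightarrow> A q j = B q j + c * C q j"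
    and col: "\<And>j. j < 2 * n \<Longrightarrow> j \<noteq> q \<Longrightarrow> A j q = B j q + c * C j q"
  shows "pfaffian n A = pfaffian n B + c * pfaffian n C"
proof -
  have "pf_term n A \<sigma> = pf_term n B \<sigma> + c * pf_term n C \<sigma>" if \<sigma>: "\<sigma> permutes {..<2 * n}" for \<sigma>
  proof -
    define k where "k = inv \<sigma> q"
    have k: "k < 2 * n" "\<sigma> k = q"
      using permutes_in_image[OF permutes_inv[OF \<sigma>], of q] permutes_inverses[OF \<sigma>] q
      by (auto simp: k_def)
    have \<sigma>_eq_q: "\<sigma> l = q \<longleftrightarrow> l = k" for l
      using inj_eq[OF permutes_inj[OF \<sigma>], of l k] k(2) by simp
    have in_range: "\<sigma> l < 2 * n" if "l < 2 * n" for l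
      using permutes_in_image[OF \<sigma>] that by auto
    \<comment> \<open>\<open>q\<close> sits at position \<open>k\<close>, hence in pair number \<open>m\<close>.\<close>
    define m where "m = k div 2"
    have m: "m < n"
      using k by (simp add: m_def)
    have k_cases: "k = 2 * m \<or> k = 2 * m + 1"
      by (auto simp: m_def)
    let ?f = "\<lambda>M i. M (\<sigma> (2 * i)) (\<sigma> (2 * i + 1)) :: complex"
    have factor: "?f A m = ?f B m + c * ?f C m"
      using k_cases
    proof
      assume "k = 2 * m"
      then show ?thesis
        using row[of "\<sigma> (2 * m + 1)"] in_range[of "2 * m + 1"] m k(2) \<sigma>_eq_q[of "2 * m + 1"] by simp
    next
      assume "k = 2 * m + 1"
      then show ?thesis
        using col[of "\<sigma> (2 * m)"] in_range[of "2 * m"] m k(2) \<sigma>_eq_q[of "2 * m"] by simp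
    qed
    have rest: "?f A i = ?f B i \<and> ?f A i = ?f C i" if "i \<in> {..<n} - {m}" for i
    proof -
      have "2 * i \<noteq> k" "2 * i + 1 \<noteq> k"
        using that k_cases by (auto; presburger)+
      then show ?thesis
        using that by (intro off in_range) (auto simp: \<sigma>_eq_q)
    qed
    have "(\<Prod>i\<in>{..<n} - {m}. ?f B i) = (\<Prod>i\<in>{..<n} - {m}. ?f A i)"
         "(\<Prod>i\<in>{..<n} - {m}. ?f C i) = (\<Prod>i\<in>{..<n} - {m}. ?f A i)"
      by (intro prod.cong refl; metis rest)+
    moreover have "(\<Prod>i<n. ?f M i) = ?f M m * (\<Prod>i\<in>{..<n} - {m}. ?f M i)" for M
      using m by (intro prod.remove) auto
    ultimately show ?thesis
      unfolding pf_term_def using factor by (simp add: algebra_simps)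
  qed
  then have "(\<Sum>\<sigma> | \<sigma> permutes {..<2 * n}. pf_term n A \<sigma>)
     = (\<Sum>\<sigma> | \<sigma> permutes {..<2 * n}. pf_term n B \<sigma>) + c * (\<Sum>\<sigma> | \<sigma> permutes {..<2 * n}. pf_term n C \<sigma>)"
    by (simp add: sum.distrib sum_distrib_left)
  then show ?thesis
    by (simp add: pfaffian_eq_sum_pf_term add_divide_distrib)
qed

lemma pfaffian_add_row_multiple:
  assumes pq: "p < 2 * n" "q < 2 * n" "p \<noteq> q"
    and off: "\<And>i j. i < 2 * n \<Longrightarrow> j < 2 * n \<Longrightarrow> i \<noteq> q \<Longrightarrow> j \<noteq> q \<Longrightarrow> B i j = A i j"
    and row: "\<And>j. j < 2 * n \<Longrightarrow> j \<noteq> q \<Longrightarrow> B q j = A q j + c * A p j"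
    and col: "\<And>j. j < 2 * n \<Longrightarrow> j \<noteq> q \<Longrightarrow> B j q = A j q + c * A j p"
  shows "pfaffian n B = pfaffian n A"
proof -
  \<comment> \<open>The change is \<open>c\<close> times the Pfaffian with row and column \<open>q\<close> overwritten by those of \<open>p\<close>.\<close>
  define r where "r i = (if i = q then p else i)" for i
  define C where "C i j = A (r i) (r j)" for i j
  have "pfaffian n B = pfaffian n A + c * pfaffian n C"
    by (rule pfaffian_linear_row[OF pq(2)]) (auto simp: C_def r_def off row col)
  also have "pfaffian n C = 0"
    by (rule pfaffian_two_equal_rows[OF pq]) (auto simp: C_def r_def pq)
  finally show ?thesis
    by simp
qed

text \<open>
  Simultaneous elimination: the matrix is \<open>A\<close>, read as a bilinear form, with every basis vector
  \<open>v\<^sub>j\<close>, \<open>j \<in> T\<close>, replaced by \<open>v\<^sub>j + c\<^sub>j v\<^sub>p\<close>.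
\<close>

lemma pfaffian_add_row_multiples:
  assumes "finite T" "T \<subseteq> {..<2 * n}" "p < 2 * n" "p \<notin> T"
  shows "pfaffian n (\<lambda>i j. A i j + (if j \<in> T then c j * A i p else 0)
      + (if i \<in> T then c i * (A p j + (if j \<in> T then c j * A p p else 0)) else 0)) = pfaffian n A"
  using assms
proof (induction T)
  case empty
  then show ?case by simp
next
  case (insert q T)
  have "pfaffian n (\<lambda>i j. A i j + (if j \<in> insert q T then c j * A i p else 0)
      + (if i \<in> insert q T then c i * (A p j + (if j \<in> insert q T then c j * A p p else 0)) else 0))
    = pfaffian n (\<lambda>i j. A i j + (if j \<in> T then c j * A i p else 0)
      + (if i \<in> T then c i * (A p j + (if j \<in> T then c j * A p p else 0)) else 0))"
    by (rule pfaffian_add_row_multiple[of p n q _ _ "c q"])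
      (use insert.prems insert.hyps in \<open>auto simp: algebra_simps\<close>)
  then show ?case
    using insert by simp
qed

text \<open>
  The permutation of the matrix indices that moves the \<open>2 \<times> 2\<close> blocks as \<open>p\<close> does and keeps the
  order inside each block.
\<close>

definition on_pairs :: "(nat \<Rightarrow> nat) \<Rightarrow> nat \<Rightarrow> nat" where
  "on_pairs p k = 2 * p (k div 2) + k mod 2"

lemma on_pairs_simps [simp]:
  "on_pairs p (2 * i) = 2 * p i" "on_pairs p (2 * i + 1) = 2 * p i + 1"
  "on_pairs p (Suc (2 * i)) = Suc (2 * p i)"
  by (auto simp: on_pairs_def)

lemma on_pairs_transpose:
  "on_pairs (transposition a b) = transposition (2 * a) (2 * b) \<circ> transposition (2 * a + 1) (2 * b + 1)"
proof
  fix k :: nat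
  have "k = 2 * (k div 2) \<or> k = 2 * (k div 2) + 1"
    by presburger
  then obtain l where "k = 2 * l \<or> k = 2 * l + 1"
    by blast
  then show "on_pairs (transposition a b) k = (transposition (2 * a) (2 * b) \<circ> transposition (2 * a + 1) (2 * b + 1)) k"
    by (elim disjE) (auto simp: Transposition.transpose_def)
qed

text \<open>
  Exchanging two blocks takes two transpositions of indices, so block permutations are even. For
  this reason the Pfaffian of a kernel does not depend on how the points are listed.
\<close>

lemma on_pairs_permutes:
  assumes "p permutes {..<n}"
  shows "on_pairs p permutes {..<2 * n} \<and> sign (on_pairs p) = 1"
  using assms finite_lessThan
proof (induction rule: permutes_induct)
  case id
  have "on_pairs id = id"
    by (auto simp: on_pairs_def)
  then show ?case
    by (metis permutes_id sign_id)
next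
  case (swap a b p)
  let ?t = "transposition (2 * a) (2 * b)" and ?t' = "transposition (2 * a + 1) (2 * b + 1)"
  have t: "?t permutes {..<2 * n}" "?t' permutes {..<2 * n}"
    using swap.hyps by (auto intro!: permutes_swap_id)
  have IH: "on_pairs p permutes {..<2 * n}" "sign (on_pairs p) = 1"
    using swap by auto
  have "on_pairs (transposition a b \<circ> p) = on_pairs (transposition a b) \<circ> on_pairs p"
    by (auto simp: on_pairs_def fun_eq_iff)
  then have eq: "on_pairs (transposition a b \<circ> p) = ?t \<circ> (?t' \<circ> on_pairs p)"
    by (simp add: on_pairs_transpose o_assoc)
  have perm: "?t' \<circ> on_pairs p permutes {..<2 * n}"
    using t IH by (intro permutes_compose) auto
  then have "?t \<circ> (?t' \<circ> on_pairs p) permutes {..<2 * n}"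
    using t(1) by (rule permutes_compose)
  moreover have "permutation ?t" "permutation ?t'" "permutation (on_pairs p)" "permutation (?t' \<circ> on_pairs p)"
    using t IH perm unfolding permutation_permutes by blast+
  then have "sign (?t \<circ> (?t' \<circ> on_pairs p)) = 1"
    using IH swap.hyps by (simp add: sign_compose sign_swap_id)
  ultimately show ?case
    unfolding eq by blast
qed

lemma pf_term_permute_pairs:
  assumes "\<sigma> permutes {..<2 * n}" "p permutes {..<n}"
  shows "pf_term n A (\<sigma> \<circ> on_pairs p) = pf_term n A \<sigma>"
proof -
  have "sign (\<sigma> \<circ> on_pairs p) = sign \<sigma>"
    using assms on_pairs_permutes[OF assms(2)]
    by (subst sign_compose) (auto simp: permutation_permutes)
  moreover have "(\<Prod>i<n. A (\<sigma> (2 * i)) (\<sigma> (2 * i + 1))) = (\<Prod>i<n. A (\<sigma> (2 * p i)) (\<sigma> (2 * p i + 1)))"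
    using prod.permute[OF assms(2), of "\<lambda>i. A (\<sigma> (2 * i)) (\<sigma> (2 * i + 1))"] by simp
  ultimately show ?thesis
    by (simp add: pf_term_def)
qed

text \<open>
  Exchanging the two members of one pair changes the sign of the permutation and, by
  antisymmetry, the sign of one factor.
\<close>

lemma pf_term_flip_pair:
  assumes \<sigma>: "\<sigma> permutes {..<2 * n}" and "antisym_upto (2 * n) A" and "m < n"
  shows "pf_term n A (\<sigma> \<circ> transposition (2 * m) (2 * m + 1)) = pf_term n A \<sigma>"
proof -
  let ?t = "transposition (2 * m) (2 * m + 1)"
  let ?f = "\<lambda>\<tau> i. A (\<tau> (2 * i)) (\<tau> (2 * i + 1))"
  have "?t permutes {..<2 * n}"
    using \<open>m < n\<close> by (intro permutes_swap_id) auto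
  then have "sign (\<sigma> \<circ> ?t) = - sign \<sigma>"
    using \<sigma> by (subst sign_compose) (auto simp: permutation_permutes sign_swap_id)
  moreover have "?f (\<sigma> \<circ> ?t) m = - ?f \<sigma> m"
    using antisym_uptoD[OF assms(2), of "\<sigma> (2 * m)" "\<sigma> (2 * m + 1)"] \<open>m < n\<close>
      permutes_in_image[OF \<sigma>] by simp
  moreover have "?f (\<sigma> \<circ> ?t) i = ?f \<sigma> i" if "i \<in> {..<n} - {m}" for i
    using that by (auto simp: Transposition.transpose_def)
  then have "(\<Prod>i\<in>{..<n} - {m}. ?f (\<sigma> \<circ> ?t) i) = (\<Prod>i\<in>{..<n} - {m}. ?f \<sigma> i)"
    by (intro prod.cong) auto
  moreover have "(\<Prod>i<n. ?f \<tau> i) = ?f \<tau> m * (\<Prod>i\<in>{..<n} - {m}. ?f \<tau> i)" for \<tau>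
    using \<open>m < n\<close> by (intro prod.remove) auto
  ultimately show ?thesis
    unfolding pf_term_def by (simp only: of_int_minus mult_minus_left mult_minus_right minus_minus)
qed

text \<open>
  A permutation that fixes \<open>0\<close> and \<open>1\<close> is a permutation of the remaining \<open>2n\<close> indices, shifted by \<open>2\<close>.
\<close>

lemma sum_pf_term_fixing_first_pair:
  "(\<Sum>\<sigma> | \<sigma> permutes {..<2 * n + 2} \<and> \<sigma> 0 = 0 \<and> \<sigma> 1 = 1. pf_term (Suc n) A \<sigma>)
     = A 0 1 * (\<Sum>\<pi> | \<pi> permutes {..<2 * n}. pf_term n (\<lambda>i j. A (i + 2) (j + 2)) \<pi>)"
proof -
  let ?s = "\<lambda>i::nat. i + 2"
  let ?I = "{..<2 * n}" and ?J = "{2..<2 * n + 2}"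
  have bij: "bij_betw ?s ?I ?J"
    by (rule bij_betw_byWitness[where f' = "\<lambda>i. i - 2"]) auto
  then have bij': "bij_betw (\<lambda>i. i - 2) ?J ?I"
    by (auto intro!: bij_betw_byWitness[where f' = ?s])
  have fixing: "{\<sigma>. \<sigma> permutes {..<2 * n + 2} \<and> \<sigma> 0 = 0 \<and> \<sigma> 1 = 1} = {\<sigma>. \<sigma> permutes ?J}"
  proof (intro Collect_cong iffI conjI; (elim conjE)?)
    fix \<sigma> assume "\<sigma> permutes {..<2 * n + 2}" "\<sigma> 0 = 0" "\<sigma> (1::nat) = (1::nat)"
    then show "\<sigma> permutes ?J"
      by (rule_tac permutes_superset) (auto simp: not_le less_2_cases_iff)
  next
    fix \<sigma> assume "\<sigma> permutes ?J"
    then show "\<sigma> permutes {..<2 * n + 2}" "\<sigma> 0 = 0" "\<sigma> 1 = 1"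
      by (auto intro: permutes_subset simp: permutes_not_in)
  qed
  have "(\<Sum>\<sigma> | \<sigma> permutes ?J. pf_term (Suc n) A \<sigma>)
      = (\<Sum>\<pi> | \<pi> permutes ?I. A 0 1 * pf_term n (\<lambda>i j. A (i + 2) (j + 2)) \<pi>)"
  proof (rule sum.reindex_bij_witness[where i = "map_permutation ?I ?s" and j = "map_permutation ?J (\<lambda>i. i - 2)"])
    fix \<sigma> assume "\<sigma> \<in> {\<sigma>. \<sigma> permutes ?J}"
    then have \<sigma>: "\<sigma> permutes ?J" by simp
    let ?\<pi> = "map_permutation ?J (\<lambda>i. i - 2) \<sigma>"
    show inv: "map_permutation ?I ?s ?\<pi> = \<sigma>"
      by (rule map_permutation_compose_inv[OF bij' \<sigma>]) auto
    show "?\<pi> \<in> {\<pi>. \<pi> permutes ?I}"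
      using map_permutation_permutes[OF bij' \<sigma>] by simp
    have "sign ?\<pi> = sign \<sigma>"
      by (rule sign_map_permutation[OF bij_betw_imp_inj_on[OF bij'] \<sigma>]) simp
    moreover have "?\<pi> i + 2 = \<sigma> (i + 2)" if "i < 2 * n" for i
    proof -
      have "2 \<le> \<sigma> (i + 2)"
        using permutes_in_image[OF \<sigma>, of "i + 2"] that by simp
      moreover have "?\<pi> i = \<sigma> (i + 2) - 2"
        using map_permutation_apply[OF bij_betw_imp_inj_on[OF bij'], of "i + 2" \<sigma>] that by simp
      ultimately show ?thesis
        by linarith
    qed
    then have "(\<Prod>i<n. A (\<sigma> (2 * Suc i)) (\<sigma> (2 * Suc i + 1)))
        = (\<Prod>i<n. A (?\<pi> (2 * i) + 2) (?\<pi> (2 * i + 1) + 2))"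
      by (intro prod.cong) auto
    moreover have "\<sigma> 0 = 0" "\<sigma> 1 = 1"
      using \<sigma> by (auto simp: permutes_not_in)
    ultimately show "A 0 1 * pf_term n (\<lambda>i j. A (i + 2) (j + 2)) ?\<pi> = pf_term (Suc n) A \<sigma>"
      unfolding pf_term_def by (subst prod.lessThan_Suc_shift) simp
  next
    fix \<pi> assume "\<pi> \<in> {\<pi>. \<pi> permutes ?I}"
    then have \<pi>: "\<pi> permutes ?I" by simp
    show "map_permutation ?J (\<lambda>i. i - 2) (map_permutation ?I ?s \<pi>) = \<pi>"
      by (rule map_permutation_compose_inv[OF bij \<pi>]) auto
    show "map_permutation ?I ?s \<pi> \<in> {\<sigma>. \<sigma> permutes ?J}"
      using map_permutation_permutes[OF bij \<pi>] by simp
  qed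
  then show ?thesis
    unfolding fixing sum_distrib_left .
qed

text \<open>
  A permutation contributes only if it puts \<open>0\<close> and \<open>1\<close> into the same pair. The position of \<open>0\<close> can
  be chosen in \<open>2n + 2\<close> ways; permuting pairs and flipping them shows that each position contributes
  as much as the first one, and the factor \<open>2n + 2\<close> is the quotient of the two normalisations.
\<close>

lemma pfaffian_clean_row:
  assumes anti: "antisym_upto (2 * n + 2) A"
    and row: "\<And>j. 2 \<le> j \<Longrightarrow> j < 2 * n + 2 \<Longrightarrow> A 0 j = 0"
  shows "pfaffian (Suc n) A = A 0 1 * pfaffian n (\<lambda>i j. A (i + 2) (j + 2))"
proof -
  let ?N = "2 * n + 2"
  let ?f = "pf_term (Suc n) A"
  \<comment> \<open>The other member of the pair of positions that contains \<open>k\<close>.\<close>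
  define partner where "partner k = (if even k then k + 1 else k - 1)" for k :: nat
  define S where "S k = {\<sigma>. \<sigma> permutes {..<?N} \<and> \<sigma> k = 0 \<and> \<sigma> (partner k) = 1}" for k
  have anti0: "A j 0 = 0" if "2 \<le> j" "j < ?N" for j
    using antisym_uptoD[OF anti, of 0 j] row[OF that] that by simp
  have class_sum: "sum ?f (S k) = sum ?f (S 0)" if "k < ?N" for k
  proof -
    define i where "i = k div 2"
    have i: "i < Suc n" "k = 2 * i \<or> k = 2 * i + 1"
      using that by (auto simp: i_def)
    define p where "p = transposition 0 i"
    have p: "p permutes {..<Suc n}"
      unfolding p_def using i by (intro permutes_swap_id) auto
    have pp: "on_pairs p permutes {..<?N}"
      using on_pairs_permutes[OF p] by simp
    \<comment> \<open>\<open>\<tau>\<close> carries the positions \<open>0, 1\<close> to \<open>k\<close> and its partner by moving whole pairs, flipping one if \<open>k\<close> is odd.\<close>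
    define \<tau> where "\<tau> = (if even k then on_pairs p else on_pairs p \<circ> transposition (2 * 0) (2 * 0 + 1))"
    have \<tau>: "\<tau> permutes {..<?N}"
      unfolding \<tau>_def using pp by (auto intro!: permutes_compose permutes_swap_id)
    have "\<tau> 0 = k \<and> \<tau> 1 = partner k"
      using i(2) on_pairs_simps[of p 0] by (auto simp: \<tau>_def partner_def p_def)
    then have \<tau>01: "\<tau> 0 = k" "\<tau> 1 = partner k" by auto
    have inv: "?f (\<sigma> \<circ> \<tau>) = ?f \<sigma>" if "\<sigma> permutes {..<?N}" for \<sigma>
    proof (cases "even k")
      case True
      then show ?thesis
        using pf_term_permute_pairs[OF _ p, of \<sigma> A] that by (simp add: \<tau>_def)
    next
      case False
      have "\<sigma> \<circ> on_pairs p permutes {..<2 * Suc n}"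
        using that pp by (simp add: permutes_compose)
      then have "?f ((\<sigma> \<circ> on_pairs p) \<circ> transposition (2 * 0) (2 * 0 + 1)) = ?f (\<sigma> \<circ> on_pairs p)"
        by (rule pf_term_flip_pair) (use anti in auto)
      then show ?thesis
        using pf_term_permute_pairs[OF _ p, of \<sigma> A] that False by (simp add: \<tau>_def o_assoc)
    qed
    have partner0: "partner 0 = 1"
      by (simp add: partner_def)
    show ?thesis
    proof (rule sum.reindex_bij_witness[where i = "\<lambda>\<sigma>. \<sigma> \<circ> inv \<tau>" and j = "\<lambda>\<sigma>. \<sigma> \<circ> \<tau>"])
      fix \<sigma> assume "\<sigma> \<in> S k"
      then show "\<sigma> \<circ> \<tau> \<in> S 0" "?f (\<sigma> \<circ> \<tau>) = ?f \<sigma>"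
        using \<tau> \<tau>01 inv by (auto simp: S_def partner0 permutes_compose)
    next
      fix \<sigma> assume "\<sigma> \<in> S 0"
      moreover have "inv \<tau> k = 0" "inv \<tau> (partner k) = 1"
        using \<tau>01 permutes_inverses[OF \<tau>] by metis+
      ultimately show "\<sigma> \<circ> inv \<tau> \<in> S k"
        using permutes_inv[OF \<tau>] by (auto simp: S_def partner0 permutes_compose)
    qed (auto simp: o_assoc[symmetric] permutes_inv_o[OF \<tau>])
  qed
  have zero: "?f \<sigma> = 0" if "\<sigma> permutes {..<?N}" "\<sigma> \<notin> (\<Union>k<?N. S k)" for \<sigma>
  proof -
    define k where "k = inv \<sigma> 0"
    have k: "k < ?N" "\<sigma> k = 0"
      using permutes_in_image[OF permutes_inv[OF that(1)], of 0] permutes_inverses[OF that(1)]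
      by (auto simp: k_def)
    have pk: "partner k < ?N"
      using k(1) unfolding partner_def by presburger
    have "partner k \<noteq> k"
      unfolding partner_def by presburger
    then have "\<sigma> (partner k) \<noteq> 0"
      using inj_eq[OF permutes_inj[OF that(1)], of "partner k" k] k(2) by simp
    moreover have "\<sigma> (partner k) \<noteq> 1"
      using that k unfolding S_def by blast
    moreover have "\<sigma> (partner k) < ?N"
      using permutes_in_image[OF that(1)] pk by auto
    ultimately have pair0: "A (\<sigma> k) (\<sigma> (partner k)) = 0" "A (\<sigma> (partner k)) (\<sigma> k) = 0"
      using k(2) row anti0 by auto
    have "A (\<sigma> (2 * (k div 2))) (\<sigma> (2 * (k div 2) + 1)) = 0"
      using pair0 by (cases "even k") (auto simp: partner_def elim!: evenE oddE)
    moreover have "k div 2 < Suc n"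
      using k by auto
    ultimately have "(\<Prod>i<Suc n. A (\<sigma> (2 * i)) (\<sigma> (2 * i + 1))) = 0"
      by (intro prod_zero) auto
    then show ?thesis
      by (simp add: pf_term_def)
  qed
  have fin: "finite {\<sigma>. \<sigma> permutes {..<?N}}"
    by (intro finite_permutations) auto
  have "(\<Sum>\<sigma> | \<sigma> permutes {..<?N}. ?f \<sigma>) = (\<Sum>\<sigma>\<in>(\<Union>k<?N. S k). ?f \<sigma>)"
  proof (rule sum.mono_neutral_right[OF fin])
    show "(\<Union>k<?N. S k) \<subseteq> {\<sigma>. \<sigma> permutes {..<?N}}"
      by (auto simp: S_def)
    show "\<forall>\<sigma>\<in>{\<sigma>. \<sigma> permutes {..<?N}} - (\<Union>k<?N. S k). ?f \<sigma> = 0"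
      using zero by blast
  qed
  also have "\<dots> = (\<Sum>k<?N. sum ?f (S k))"
  proof (rule sum.UNION_disjoint)
    show "\<forall>k\<in>{..<?N}. finite (S k)"
      using fin by (auto simp: S_def)
    show "\<forall>k\<in>{..<?N}. \<forall>l\<in>{..<?N}. k \<noteq> l \<longrightarrow> S k \<inter> S l = {}"
    proof (intro ballI impI equals0I)
      fix k l \<sigma> assume "k \<noteq> l" "\<sigma> \<in> S k \<inter> S l"
      then have "\<sigma> k = \<sigma> l" "inj \<sigma>"
        by (auto simp: S_def permutes_inj)
      then show False
        using \<open>k \<noteq> l\<close> by (simp add: inj_eq)
    qed
  qed simp
  also have "\<dots> = (\<Sum>k<?N. sum ?f (S 0))"
    by (intro sum.cong refl class_sum) simp
  also have "\<dots> = of_nat ?N * sum ?f (S 0)"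
    by simp
  also have "sum ?f (S 0) = A 0 1 * (\<Sum>\<pi> | \<pi> permutes {..<2 * n}. pf_term n (\<lambda>i j. A (i + 2) (j + 2)) \<pi>)"
    using sum_pf_term_fixing_first_pair[of n A] by (simp add: S_def partner_def)
  finally have total: "(\<Sum>\<sigma> | \<sigma> permutes {..<2 * Suc n}. ?f \<sigma>)
      = of_nat ?N * (A 0 1 * (\<Sum>\<pi> | \<pi> permutes {..<2 * n}. pf_term n (\<lambda>i j. A (i + 2) (j + 2)) \<pi>))"
    by simp
  have "(of_nat ?N :: complex) = 2 * of_nat (Suc n)"
    by simp
  then show ?thesis
    unfolding pfaffian_eq_sum_pf_term total by (simp add: fact_Suc divide_simps del: of_nat_Suc)
qed

text \<open>
  Adding multiples of row \<open>1\<close> to the later rows clears row \<open>0\<close> and turns the remaining matrix into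
  the Schur complement of the leading \<open>2 \<times> 2\<close> block.
\<close>

lemma pfaffian_pivot:
  assumes anti: "antisym_upto (2 * n + 2) A" and pivot: "A 0 1 \<noteq> 0"
  shows "pfaffian (Suc n) A = A 0 1 * pfaffian n (\<lambda>i j. A (i + 2) (j + 2)
      - A 0 (j + 2) / A 0 1 * A (i + 2) 1 - A 0 (i + 2) / A 0 1 * A 1 (j + 2))"
proof -
  let ?N = "2 * n + 2"
  \<comment> \<open>Adding \<open>c\<^sub>j\<close> times row \<open>1\<close> to row \<open>j\<close> makes the entry \<open>(0, j)\<close> vanish.\<close>
  define c where "c j = - A 0 j / A 0 1" for j
  define T where "T = {2..<?N}"
  define B where "B i j = A i j + (if j \<in> T then c j * A i 1 else 0)
      + (if i \<in> T then c i * (A 1 j + (if j \<in> T then c j * A 1 1 else 0)) else 0)" for i j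
  have anti': "A j i = - A i j" if "i < ?N" "j < ?N" for i j
    by (rule antisym_uptoD[OF anti that])
  have A11: "A 1 1 = 0"
    using anti'[of 1 1] by (simp add: eq_neg_iff_add_eq_0)
  have "pfaffian (Suc n) A = pfaffian (Suc n) B"
    unfolding B_def by (rule pfaffian_add_row_multiples[symmetric]) (auto simp: T_def)
  also have "\<dots> = B 0 1 * pfaffian n (\<lambda>i j. B (i + 2) (j + 2))"
  proof (rule pfaffian_clean_row)
    show "antisym_upto ?N B"
      unfolding antisym_upto_def
    proof (intro allI impI)
      fix i j assume ij: "i < ?N" "j < ?N"
      have "A j 1 = - A 1 j" "A i 1 = - A 1 i" "A j i = - A i j"
        using ij by (auto intro: anti')
      then show "B j i = - B i j"
        by (simp add: B_def A11[simplified] algebra_simps)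
    qed
    show "B 0 j = 0" if "2 \<le> j" "j < ?N" for j
      using that pivot by (simp add: B_def T_def c_def)
  qed
  also have "B 0 1 = A 0 1"
    by (simp add: B_def T_def)
  also have "pfaffian n (\<lambda>i j. B (i + 2) (j + 2)) = pfaffian n (\<lambda>i j. A (i + 2) (j + 2)
      - A 0 (j + 2) / A 0 1 * A (i + 2) 1 - A 0 (i + 2) / A 0 1 * A 1 (j + 2))"
    by (rule pfaffian_cong) (simp add: B_def T_def A11[simplified] c_def)
  finally show ?thesis .
qed

text \<open>
  Subtracts the standard symplectic matrix from the leading \<open>2 \<times> 2\<close> block. On the level of
  Pfaffians this passes, up to sign, from the event that the first point is occupied to the event
  that it is vacant.
\<close>

definition lower_first_pair :: "(nat \<Rightarrow> nat \<Rightarrow> complex) \<Rightarrow> nat \<Rightarrow> nat \<Rightarrow> complex" where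
  "lower_first_pair A i j =
     A i j + (if i = 0 \<and> j = 1 then -1 else if i = 1 \<and> j = 0 then 1 else 0)"

text \<open>
  By linearity in row \<open>0\<close> the change splits off the Pfaffian of a matrix whose row \<open>0\<close> has the single
  entry \<open>1\<close>, in column \<open>1\<close>.
\<close>

lemma pfaffian_lower_first_pair:
  assumes anti: "antisym_upto (2 * n + 2) A"
  shows "pfaffian (Suc n) (lower_first_pair A)
    = pfaffian (Suc n) A - pfaffian n (\<lambda>i j. A (i + 2) (j + 2))"
proof -
  define C where "C i j = (if i = 0 \<or> j = 0
      then if i = 0 \<and> j = 1 then 1 else if i = 1 \<and> j = 0 then -1 else 0 else A i j)" for i j
  have "pfaffian (Suc n) (lower_first_pair A) = pfaffian (Suc n) A + (-1) * pfaffian (Suc n) C"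
    by (rule pfaffian_linear_row[of 0]) (auto simp: lower_first_pair_def C_def)
  also have "pfaffian (Suc n) C = C 0 1 * pfaffian n (\<lambda>i j. C (i + 2) (j + 2))"
  proof (rule pfaffian_clean_row)
    show "antisym_upto (2 * n + 2) C"
      unfolding antisym_upto_def
    proof (intro allI impI)
      fix i j assume "i < 2 * n + 2" "j < 2 * n + 2"
      from antisym_uptoD[OF anti this] show "C j i = - C i j"
        by (simp add: C_def)
    qed
  qed (simp add: C_def)
  also have "\<dots> = pfaffian n (\<lambda>i j. A (i + 2) (j + 2))"
    by (simp add: C_def)
  finally show ?thesis
    by simp
qed


section \<open>The doubled Hilbert space\<close>

lemma KK_iff:
  "v \<in> KK A \<longleftrightarrow> (\<forall>x. x \<notin> A \<longrightarrow> fst v x = 0 \<and> snd v x = 0) \<and>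
     (\<lambda>x. (cmod (fst v x))\<^sup>2) summable_on UNIV \<and> (\<lambda>x. (cmod (snd v x))\<^sup>2) summable_on UNIV"
  by (auto simp: KK_def ell2_def mem_Times_iff)

lemma KK_mono: "A \<subseteq> B \<Longrightarrow> KK A \<subseteq> KK B"
  unfolding subset_iff KK_iff by blast

lemma KK_Diff_singleton: "v \<in> KK (A - {x}) \<longleftrightarrow> v \<in> KK A \<and> fst v x = 0 \<and> snd v x = 0"
  by (auto simp: KK_iff)

lemma square_summable_add:
  fixes f g :: "'a \<Rightarrow> complex"
  assumes "(\<lambda>x. (cmod (f x))\<^sup>2) summable_on UNIV" "(\<lambda>x. (cmod (g x))\<^sup>2) summable_on UNIV"
  shows "(\<lambda>x. (cmod (f x + g x))\<^sup>2) summable_on UNIV"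
proof (rule summable_on_comparison_test)
  show "(\<lambda>x. 2 * (cmod (f x))\<^sup>2 + 2 * (cmod (g x))\<^sup>2) summable_on UNIV"
    using assms by (intro summable_on_add summable_on_cmult_right)
  fix x
  have "(cmod (f x + g x))\<^sup>2 \<le> (cmod (f x) + cmod (g x))\<^sup>2"
    by (intro power_mono norm_triangle_ineq) auto
  also have "\<dots> \<le> 2 * (cmod (f x))\<^sup>2 + 2 * (cmod (g x))\<^sup>2"
    using zero_le_power2[of "cmod (f x) - cmod (g x)"] by (simp add: power2_eq_square algebra_simps)
  finally show "(cmod (f x + g x))\<^sup>2 \<le> 2 * (cmod (f x))\<^sup>2 + 2 * (cmod (g x))\<^sup>2" .
qed simp

lemma KK_add: "u \<in> KK A \<Longrightarrow> v \<in> KK A \<Longrightarrow> u + v \<in> KK A"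
  by (auto simp: KK_iff square_summable_add)

lemma KK_scale_closed: "v \<in> KK A \<Longrightarrow> KK_scale c v \<in> KK A"
  by (auto simp: KK_iff KK_scale_def norm_mult power_mult_distrib intro: summable_on_cmult_right)

lemma KK_scale_minus_one: "KK_scale (- 1) v = - v"
  by (auto simp: KK_scale_def prod_eq_iff fun_eq_iff)

lemma KK_diff: "u \<in> KK A \<Longrightarrow> v \<in> KK A \<Longrightarrow> u - v \<in> KK A"
  using KK_add[of u A "- v"] KK_scale_closed[of v A "- 1"] by (simp add: KK_scale_minus_one)

lemma KK_zero: "0 \<in> KK A"
  by (auto simp: KK_iff)

lemma KK_Gamma: "v \<in> KK A \<Longrightarrow> Gamma v \<in> KK A"
  by (auto simp: KK_iff Gamma_def conj_J_def)

lemmas KK_closed = KK_add KK_scale_closed KK_diff KK_zero KK_Gamma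

lemma Gamma_Gamma [simp]: "Gamma (Gamma v) = v"
  by (simp add: Gamma_def conj_J_def)

lemma Gamma_diff: "Gamma (u - v) = Gamma u - Gamma v"
  by (simp add: Gamma_def conj_J_def fun_eq_iff)

lemma Gamma_scale: "Gamma (KK_scale c v) = KK_scale (cnj c) (Gamma v)"
  by (simp add: Gamma_def conj_J_def KK_scale_def)

lemma Gamma_zero [simp]: "Gamma 0 = 0"
  by (simp add: Gamma_def conj_J_def prod_eq_iff fun_eq_iff)

lemma ell2_product_summable:
  fixes f g :: "'a \<Rightarrow> complex"
  assumes "(\<lambda>x. (cmod (f x))\<^sup>2) summable_on UNIV" "(\<lambda>x. (cmod (g x))\<^sup>2) summable_on UNIV"
  shows "(\<lambda>x. cnj (f x) * g x) summable_on UNIV"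
proof (rule abs_summable_summable, rule summable_on_comparison_test)
  show "(\<lambda>x. (cmod (f x))\<^sup>2 + (cmod (g x))\<^sup>2) summable_on UNIV"
    using assms by (rule summable_on_add)
  fix x
  have "2 * (cmod (f x) * cmod (g x)) \<le> (cmod (f x))\<^sup>2 + (cmod (g x))\<^sup>2"
    using zero_le_power2[of "cmod (f x) - cmod (g x)"] by (simp add: power2_eq_square algebra_simps)
  moreover have "0 \<le> cmod (f x) * cmod (g x)"
    by simp
  ultimately show "norm (cnj (f x) * g x) \<le> (cmod (f x))\<^sup>2 + (cmod (g x))\<^sup>2"
    unfolding norm_mult complex_mod_cnj by linarith
qed simp

lemma KK_inner_commute: "KK_inner v u = cnj (KK_inner u v)"
  by (simp add: KK_inner_def ell2_inner_def flip: infsum_cnj) (simp add: mult.commute)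

lemma KK_inner_scale_right: "KK_inner u (KK_scale c v) = c * KK_inner u v"
proof -
  have "ell2_inner f (\<lambda>x. c * g x) = c * ell2_inner f g" for f g :: "'a \<Rightarrow> complex"
    unfolding ell2_inner_def by (simp add: mult.left_commute infsum_cmult_right')
  then show ?thesis
    by (simp add: KK_inner_def KK_scale_def algebra_simps)
qed

lemma KK_inner_add_right:
  assumes "u \<in> KK A" "v \<in> KK A" "w \<in> KK A"
  shows "KK_inner u (v + w) = KK_inner u v + KK_inner u w"
  using assms unfolding KK_inner_def ell2_inner_def KK_iff
  by (simp add: distrib_left infsum_add ell2_product_summable)

lemma KK_inner_diff_right:
  assumes "u \<in> KK A" "v \<in> KK A" "w \<in> KK A"
  shows "KK_inner u (v - w) = KK_inner u v - KK_inner u w"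
  using KK_inner_add_right[OF assms(1,2) KK_scale_closed[OF assms(3), of "- 1"]]
  by (simp only: KK_inner_scale_right) (simp add: KK_scale_minus_one)

lemma KK_inner_diff_left:
  assumes "u \<in> KK A" "v \<in> KK A" "w \<in> KK A"
  shows "KK_inner (v - w) u = KK_inner v u - KK_inner w u"
  by (metis KK_inner_diff_right[OF assms] KK_inner_commute complex_cnj_diff)

lemma KK_inner_Gamma: "KK_inner (Gamma u) (Gamma v) = KK_inner v u"
  by (simp add: KK_inner_def ell2_inner_def Gamma_def conj_J_def mult.commute)

text \<open>
  A sum of squares that diverges has the default value \<open>0\<close> on both sides.
\<close>

lemma KK_inner_self:
  "KK_inner v v = of_real ((\<Sum>\<^sub>\<infinity>x. (cmod (fst v x))\<^sup>2) + (\<Sum>\<^sub>\<infinity>x. (cmod (snd v x))\<^sup>2))"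
proof -
  have "ell2_inner f f = of_real (\<Sum>\<^sub>\<infinity>x. (cmod (f x))\<^sup>2)" for f :: "'a \<Rightarrow> complex"
  proof -
    have "cnj (f x) * f x = of_real ((cmod (f x))\<^sup>2)" for x
      by (metis complex_norm_square mult.commute)
    moreover have "(\<Sum>\<^sub>\<infinity>x. complex_of_real (h x)) = of_real (\<Sum>\<^sub>\<infinity>x. h x)" for h :: "'a \<Rightarrow> real"
    proof (cases "h summable_on UNIV")
      case True
      then show ?thesis
        by (intro infsumI has_sum_of_real has_sum_infsum)
    next
      case False
      then have "\<not> (\<lambda>x. complex_of_real (h x)) summable_on UNIV"
        using summable_on_Re by fastforce
      then show ?thesis
        using False by (simp add: infsum_not_exists)
    qed
    ultimately show ?thesis
      by (simp add: ell2_inner_def del: of_real_power)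
  qed
  then show ?thesis
    by (simp add: KK_inner_def)
qed

lemma cmod_coord_le_KK_inner_self:
  assumes "v \<in> KK A"
  shows "(cmod (fst v x))\<^sup>2 \<le> Re (KK_inner v v)" "(cmod (snd v x))\<^sup>2 \<le> Re (KK_inner v v)"
proof -
  have le: "(cmod (f x))\<^sup>2 \<le> (\<Sum>\<^sub>\<infinity>y. (cmod (f y))\<^sup>2)"
    if "(\<lambda>y. (cmod (f y))\<^sup>2) summable_on UNIV" for f :: "'a \<Rightarrow> complex"
    using finite_sum_le_infsum[OF that, of "{x}"] by simp
  have nonneg: "0 \<le> (\<Sum>\<^sub>\<infinity>y. (cmod (f y))\<^sup>2)" for f :: "'a \<Rightarrow> complex"
    by (intro infsum_nonneg) simp
  show "(cmod (fst v x))\<^sup>2 \<le> Re (KK_inner v v)" "(cmod (snd v x))\<^sup>2 \<le> Re (KK_inner v v)"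
    using assms le[of "fst v"] le[of "snd v"] nonneg[of "fst v"] nonneg[of "snd v"]
    by (auto simp: KK_inner_self KK_iff)
qed

lemma KK_inner_self_nonneg: "0 \<le> Re (KK_inner v v)"
  by (auto simp: KK_inner_self intro!: add_nonneg_nonneg infsum_nonneg)

lemma KK_inner_self_eq_0_iff:
  assumes "v \<in> KK A"
  shows "Re (KK_inner v v) = 0 \<longleftrightarrow> v = 0"
proof
  assume "Re (KK_inner v v) = 0"
  then show "v = 0"
    using cmod_coord_le_KK_inner_self[OF assms] by (simp add: prod_eq_iff fun_eq_iff)
qed (simp add: KK_inner_self)

text \<open>
  The basis vector at \<open>x\<close> in the summand \<open>\<K>\<^sup>+\<close> (flag \<open>True\<close>) or \<open>\<K>\<^sup>-\<close> (flag \<open>False\<close>). The flag is the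
  state of the point that is being prescribed: occupied points enter a regularity condition through
  \<open>\<K>\<^sup>+\<close>, vacant ones through \<open>\<K>\<^sup>-\<close>.
\<close>

definition ket :: "'a \<Rightarrow> bool \<Rightarrow> 'a dvec" where
  "ket x b = (if b then (unit_vec x, 0) else (0, unit_vec x))"

lemma ell2_inner_unit_vec: "ell2_inner (unit_vec x) f = f x"
proof -
  have "ell2_inner (unit_vec x) f = (\<Sum>\<^sub>\<infinity>y\<in>{x}. f y)"
    unfolding ell2_inner_def by (rule infsum_cong_neutral) (auto simp: unit_vec_def)
  then show ?thesis
    by simp
qed

lemma KK_inner_ket: "KK_inner (ket x b) v = (if b then fst v x else snd v x)"
  by (simp add: KK_inner_def ket_def ell2_inner_unit_vec) (simp add: ell2_inner_def)

lemma ket_in_KK: "x \<in> A \<Longrightarrow> ket x b \<in> KK A"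
proof -
  assume "x \<in> A"
  have "(\<lambda>y. (cmod (unit_vec x y))\<^sup>2) summable_on UNIV"
    by (rule finite_nonzero_values_imp_summable_on)
      (auto simp: unit_vec_def intro: finite_subset[of _ "{x}"])
  then show ?thesis
    using \<open>x \<in> A\<close> by (auto simp: KK_iff ket_def unit_vec_def)
qed

lemma Gamma_ket [simp]: "Gamma (ket x b) = ket x (\<not> b)"
  by (auto simp: Gamma_def ket_def conj_J_def unit_vec_def fun_eq_iff)

lemma KK_inner_ket_ket: "KK_inner (ket x b) (ket y c) = (if x = y \<and> b = c then 1 else 0)"
  unfolding KK_inner_ket by (auto simp: ket_def unit_vec_def)

lemma KK_inner_ket_scale: "KK_inner (ket x b) (KK_scale c v) = c * KK_inner (ket x b) v"
  by (rule KK_inner_scale_right)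

lemma KK_inner_ket_diff: "KK_inner (ket x b) (v - w) = KK_inner (ket x b) v - KK_inner (ket x b) w"
  by (simp add: KK_inner_ket)

lemma KK_inner_ket_add: "KK_inner (ket x b) (v + w) = KK_inner (ket x b) v + KK_inner (ket x b) w"
  by (simp add: KK_inner_ket)

lemma KK_Diff_singleton_ket:
  "v \<in> KK (A - {x}) \<longleftrightarrow> v \<in> KK A \<and> KK_inner (ket x b) v = 0 \<and> KK_inner (ket x (\<not> b)) v = 0"
  by (auto simp: KK_Diff_singleton KK_inner_ket)


section \<open>Projections and their reduction at one point\<close>

lemma GrD:
  assumes "P \<in> Gr A"
  shows Gr_closed: "v \<in> KK A \<Longrightarrow> P v \<in> KK A"
    and Gr_add: "u \<in> KK A \<Longrightarrow> v \<in> KK A \<Longrightarrow> P (u + v) = P u + P v"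
    and Gr_scale: "v \<in> KK A \<Longrightarrow> P (KK_scale c v) = KK_scale c (P v)"
    and Gr_idem: "v \<in> KK A \<Longrightarrow> P (P v) = P v"
    and Gr_sym: "u \<in> KK A \<Longrightarrow> v \<in> KK A \<Longrightarrow> KK_inner (P u) v = KK_inner u (P v)"
    and Gr_Gamma: "v \<in> KK A \<Longrightarrow> Gamma (P (Gamma v)) = v - P v"
  using assms by (auto simp: Gr_def is_orth_projection_on_def)

lemma Gr_diff:
  assumes "P \<in> Gr A" "u \<in> KK A" "v \<in> KK A"
  shows "P (u - v) = P u - P v"
  using Gr_add[OF assms(1,2) KK_scale_closed[OF assms(3), of "- 1"]] Gr_scale[OF assms(1,3), of "- 1"]
  by (simp add: KK_scale_minus_one)

text \<open>
  Since \<open>\<Gamma>P\<Gamma> = 1 - P\<close>, the bilinear form \<open>\<langle>\<Gamma>a, P b\<rangle>\<close> is antisymmetric up to \<open>\<langle>\<Gamma>b, a\<rangle>\<close>. The identity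
  summand that is subtracted in the kernel removes exactly this defect.
\<close>

lemma Gr_antisymmetry:
  assumes P: "P \<in> Gr A" and a: "a \<in> KK A" and b: "b \<in> KK A"
  shows "KK_inner (Gamma a) (P b) + KK_inner (Gamma b) (P a) = KK_inner (Gamma b) a"
proof -
  have "KK_inner (Gamma a) (P b) = KK_inner (Gamma (P b)) a"
    using KK_inner_Gamma[of a "Gamma (P b)"] by simp
  also have "Gamma (P b) = Gamma (P (Gamma (Gamma b)))"
    by simp
  also have "\<dots> = Gamma b - P (Gamma b)"
    by (rule Gr_Gamma[OF P KK_Gamma[OF b]])
  also have "KK_inner \<dots> a = KK_inner (Gamma b) a - KK_inner (P (Gamma b)) a"
    by (rule KK_inner_diff_left[OF a]) (auto intro: Gr_closed[OF P] KK_Gamma b)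
  also have "KK_inner (P (Gamma b)) a = KK_inner (Gamma b) (P a)"
    by (rule Gr_sym[OF P KK_Gamma[OF b] a])
  finally show ?thesis
    by simp
qed

text \<open>
  With \<open>u = ket x b\<close> and \<open>\<Gamma>u = ket x (\<not> b)\<close> this is \<open>\<langle>\<Gamma>u, P\<Gamma>u\<rangle> = \<parallel>(1 - P)u\<parallel>\<^sup>2\<close>, the probability that
  the point \<open>x\<close> has state \<open>b\<close>.
\<close>

definition point_prob :: "('a dvec \<Rightarrow> 'a dvec) \<Rightarrow> 'a \<Rightarrow> bool \<Rightarrow> real" where
  "point_prob P x b = Re (KK_inner (ket x (\<not> b)) (P (ket x (\<not> b))))"

text \<open>
  For \<open>u = ket x b\<close> the antisymmetry gives \<open>\<langle>u, P\<Gamma>u\<rangle> = 0\<close> and \<open>\<langle>u, P u\<rangle> + \<langle>\<Gamma>u, P\<Gamma>u\<rangle> = 1\<close>; that \<open>P\<close> is a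
  projection gives \<open>\<langle>\<Gamma>u, P\<Gamma>u\<rangle> = \<parallel>P\<Gamma>u\<parallel>\<^sup>2\<close>, which is why a vanishing probability forces \<open>P\<Gamma>u = 0\<close>.
\<close>

lemma
  assumes P: "P \<in> Gr A" and x: "x \<in> A"
  shows KK_inner_ket_P_Gamma_ket: "KK_inner (ket x b) (P (ket x (\<not> b))) = 0"
    and KK_inner_Gamma_ket_P: "KK_inner (ket x (\<not> b)) (P (ket x (\<not> b))) = of_real (point_prob P x b)"
    and KK_inner_ket_P: "KK_inner (ket x b) (P (ket x b)) = 1 - of_real (point_prob P x b)"
    and point_prob_nonneg: "0 \<le> point_prob P x b"
    and point_prob_eq_0: "point_prob P x b = 0 \<Longrightarrow> P (ket x (\<not> b)) = 0 \<and> P (ket x b) = ket x b"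
proof -
  let ?u = "ket x b" and ?g = "ket x (\<not> b)"
  have u: "?u \<in> KK A" and g: "?g \<in> KK A"
    by (simp_all add: ket_in_KK x)
  show "KK_inner ?u (P ?g) = 0"
    using Gr_antisymmetry[OF P g g] by (simp add: KK_inner_ket_ket)
  have self: "KK_inner ?g (P ?g) = KK_inner (P ?g) (P ?g)"
    using Gr_sym[OF P g Gr_closed[OF P g]] by (simp add: Gr_idem[OF P g])
  then have prob: "KK_inner ?g (P ?g) = of_real (Re (KK_inner (P ?g) (P ?g)))"
    by (simp only:) (simp add: KK_inner_self)
  show g_prob: "KK_inner ?g (P ?g) = of_real (point_prob P x b)"
    unfolding point_prob_def by (subst (1 2) prob) simp
  show "0 \<le> point_prob P x b"
    unfolding point_prob_def by (simp add: self KK_inner_self_nonneg)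
  show "KK_inner ?u (P ?u) = 1 - of_real (point_prob P x b)"
    using Gr_antisymmetry[OF P g u] g_prob by (simp add: KK_inner_ket_ket algebra_simps)
  show "P ?g = 0 \<and> P ?u = ?u" if "point_prob P x b = 0"
  proof -
    have "Re (KK_inner (P ?g) (P ?g)) = 0"
      using that self by (simp add: point_prob_def)
    then have "P ?g = 0"
      by (simp only: KK_inner_self_eq_0_iff[OF Gr_closed[OF P g]])
    moreover have "Gamma (P (Gamma ?u)) = ?u - P ?u"
      by (rule Gr_Gamma[OF P u])
    ultimately show ?thesis
      by simp
  qed
qed

text \<open>
  The orthogonal projection onto \<open>(P\<K> + \<complex>u) \<inter> \<K>\<^bsub>A - {x}\<^esub>\<close>, \<open>u = ket x b\<close>. One looks for it in the form
  \<open>w = p - \<langle>u, p\<rangle> u\<close> with \<open>p = P v + \<alpha> P\<Gamma>u + \<beta> P u\<close>. That \<open>v - w\<close> is orthogonal to the subspace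
  requires \<open>\<beta> = \<langle>u, p\<rangle>\<close>, membership requires \<open>\<langle>\<Gamma>u, p\<rangle> = 0\<close>, and since \<open>\<langle>u, P\<Gamma>u\<rangle> = 0\<close> these equations have
  the solution \<open>\<alpha> = -\<langle>\<Gamma>u, P v\<rangle> / d\<close>, \<open>\<beta> = \<langle>u, P v\<rangle> / d\<close> with \<open>d = \<langle>\<Gamma>u, P\<Gamma>u\<rangle>\<close>.
\<close>

definition reduce_at :: "('a dvec \<Rightarrow> 'a dvec) \<Rightarrow> 'a \<Rightarrow> bool \<Rightarrow> 'a dvec \<Rightarrow> 'a dvec" where
  "reduce_at P x b v =
     P v - KK_scale (KK_inner (ket x (\<not> b)) (P v) / of_real (point_prob P x b)) (P (ket x (\<not> b)))
         - KK_scale (KK_inner (ket x b) (P v) / of_real (point_prob P x b)) (ket x b - P (ket x b))"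

context
  fixes A :: "'a set" and P :: "'a dvec \<Rightarrow> 'a dvec" and x :: 'a and b :: bool
  assumes P: "P \<in> Gr A" and x: "x \<in> A" and prob_nz: "point_prob P x b \<noteq> 0"
begin

lemma reduce_at_closed:
  assumes v: "v \<in> KK (A - {x})"
  shows "reduce_at P x b v \<in> KK (A - {x})"
proof -
  have vA: "v \<in> KK A"
    using v by (simp add: KK_Diff_singleton)
  have "reduce_at P x b v \<in> KK A"
    unfolding reduce_at_def by (intro KK_closed Gr_closed[OF P] ket_in_KK x vA)
  moreover have "KK_inner (ket x b) (reduce_at P x b v) = 0"
    using prob_nz KK_inner_ket_P_Gamma_ket[OF P x, of b]
    by (simp add: reduce_at_def KK_inner_ket_diff KK_inner_ket_scale KK_inner_ket_ket KK_inner_ket_P[OF P x])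
  moreover have "KK_inner (ket x (\<not> b)) (reduce_at P x b v) = 0"
    using prob_nz KK_inner_ket_P_Gamma_ket[OF P x, of "\<not> b"]
    by (simp add: reduce_at_def KK_inner_ket_diff KK_inner_ket_scale KK_inner_ket_ket KK_inner_Gamma_ket_P[OF P x])
  ultimately show ?thesis
    by (simp add: KK_Diff_singleton_ket[where b = b])
qed

lemma reduce_at_in_range:
  assumes v: "v \<in> KK A"
  shows "\<exists>p\<in>P ` KK A. \<exists>c. reduce_at P x b v = p + KK_scale c (ket x b)"
proof -
  let ?d = "complex_of_real (point_prob P x b)"
  let ?s = "KK_inner (ket x (\<not> b)) (P v) / ?d" and ?t = "KK_inner (ket x b) (P v) / ?d"
  let ?p = "v - KK_scale ?s (ket x (\<not> b)) + KK_scale ?t (ket x b)"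
  have kets: "ket x b \<in> KK A" "ket x (\<not> b) \<in> KK A"
    by (simp_all add: ket_in_KK x)
  have "P ?p = P v - KK_scale ?s (P (ket x (\<not> b))) + KK_scale ?t (P (ket x b))"
    using v kets by (simp add: Gr_add[OF P] Gr_diff[OF P] Gr_scale[OF P] KK_closed)
  moreover have "reduce_at P x b v
      = (P v - KK_scale ?s (P (ket x (\<not> b))) + KK_scale ?t (P (ket x b))) + KK_scale (- ?t) (ket x b)"
    by (simp add: reduce_at_def KK_scale_def prod_eq_iff fun_eq_iff algebra_simps diff_divide_distrib)
  ultimately have "reduce_at P x b v = P ?p + KK_scale (- ?t) (ket x b)"
    by (simp only:)
  moreover have "?p \<in> KK A"
    using v kets by (intro KK_closed)
  ultimately show ?thesis
    by blast
qed

text \<open>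
  If \<open>p + c u\<close> is orthogonal to \<open>u\<close> and \<open>\<Gamma>u\<close>, then \<open>\<langle>u, p\<rangle> = -c\<close> and \<open>\<langle>\<Gamma>u, p\<rangle> = 0\<close>, and in the formula for
  the reduced operator the correction terms restore the part of \<open>c u\<close> that \<open>P\<close> removes.
\<close>

lemma reduce_at_fixes:
  assumes p: "p \<in> P ` KK A" and n: "n = p + KK_scale c (ket x b)" and n_in: "n \<in> KK (A - {x})"
  shows "reduce_at P x b n = n"
proof -
  let ?u = "ket x b" and ?g = "ket x (\<not> b)" and ?d = "complex_of_real (point_prob P x b)"
  have u: "?u \<in> KK A"
    by (simp add: ket_in_KK x)
  have pA: "p \<in> KK A" "P p = p"
    using p Gr_closed[OF P] Gr_idem[OF P] by auto
  have Pn: "P n = p + KK_scale c (P ?u)"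
    using pA u by (simp add: n Gr_add[OF P] Gr_scale[OF P] KK_closed)
  have p_u: "KK_inner ?u p = - c" and p_g: "KK_inner ?g p = 0"
    using n_in by (simp_all add: KK_Diff_singleton_ket[where b = b] n KK_inner_ket_add KK_inner_ket_scale
        KK_inner_ket_ket eq_neg_iff_add_eq_0)
  have "KK_inner ?g (P n) = 0"
    using KK_inner_ket_P_Gamma_ket[OF P x, of "\<not> b"] p_g
    by (simp add: Pn KK_inner_ket_add KK_inner_ket_scale)
  moreover have "KK_inner ?u (P n) = - c * ?d"
    by (simp add: Pn KK_inner_ket_add KK_inner_ket_scale p_u KK_inner_ket_P[OF P x] algebra_simps)
  ultimately have "reduce_at P x b n = (p + KK_scale c (P ?u)) - KK_scale (0 / ?d) (P ?g)
      - KK_scale (- c * ?d / ?d) (?u - P ?u)"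
    unfolding reduce_at_def by (simp only: Pn)
  then show ?thesis
    using prob_nz by (simp add: n KK_scale_def prod_eq_iff fun_eq_iff algebra_simps)
qed

text \<open>
  Conjugation by \<open>\<Gamma>\<close> exchanges the two correction terms, because \<open>\<Gamma>P\<Gamma>u = u - P u\<close>, and changes the
  sign of both coefficients, because \<open>v\<close> is orthogonal to \<open>u\<close> and \<open>\<Gamma>u\<close>.
\<close>

lemma reduce_at_Gamma:
  assumes v: "v \<in> KK (A - {x})"
  shows "Gamma (reduce_at P x b (Gamma v)) = v - reduce_at P x b v"
proof -
  let ?u = "ket x b" and ?g = "ket x (\<not> b)" and ?d = "complex_of_real (point_prob P x b)"
  have u: "?u \<in> KK A" and vA: "v \<in> KK A" and v_u: "KK_inner ?u v = 0" and v_g: "KK_inner ?g v = 0"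
    using v by (simp_all add: ket_in_KK x KK_Diff_singleton_ket[where b = b])
  have Pv: "Gamma (P (Gamma v)) = v - P v"
    by (rule Gr_Gamma[OF P vA])
  then have PGv: "P (Gamma v) = Gamma (v - P v)"
    by (metis Gamma_Gamma)
  have Pg: "Gamma (P ?g) = ?u - P ?u"
    using Gr_Gamma[OF P u] by simp
  then have Pu: "Gamma (?u - P ?u) = P ?g"
    by (metis Gamma_Gamma)
  have cnj_ket: "cnj (KK_inner ?g (Gamma w)) = KK_inner ?u w" "cnj (KK_inner ?u (Gamma w)) = KK_inner ?g w" for w
    by (auto simp: KK_inner_ket Gamma_def conj_J_def)
  have "cnj (KK_inner ?g (P (Gamma v))) = - KK_inner ?u (P v)"
    "cnj (KK_inner ?u (P (Gamma v))) = - KK_inner ?g (P v)"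
    by (simp_all only: PGv cnj_ket) (simp_all add: KK_inner_ket_diff v_u v_g)
  then have "Gamma (reduce_at P x b (Gamma v)) =
      (v - P v) - KK_scale (- KK_inner ?u (P v) / ?d) (?u - P ?u) - KK_scale (- KK_inner ?g (P v) / ?d) (P ?g)"
    unfolding reduce_at_def Gamma_diff[of "_ - _" "KK_scale _ _"] Gamma_diff[of "P _" "KK_scale _ _"] Gamma_scale Pg Pu Pv
    by simp
  then show ?thesis
    by (simp add: reduce_at_def KK_scale_def prod_eq_iff fun_eq_iff algebra_simps)
qed

text \<open>
  On vectors orthogonal to \<open>u\<close> the correction is the difference of the two Hermitian forms
  \<open>\<langle>\<Gamma>u, P y\<rangle> \<langle>\<Gamma>u, P z\<rangle>\<^sup>*\<close> and \<open>\<langle>u, P y\<rangle> \<langle>u, P z\<rangle>\<^sup>*\<close>.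
\<close>

lemma reduce_at_sym:
  assumes v: "v \<in> KK (A - {x})" and w: "w \<in> KK (A - {x})"
  shows "KK_inner (reduce_at P x b v) w = KK_inner v (reduce_at P x b w)"
proof -
  let ?u = "ket x b" and ?g = "ket x (\<not> b)" and ?d = "complex_of_real (point_prob P x b)"
  have formula: "KK_inner z (reduce_at P x b y) = KK_inner z (P y)
      - (KK_inner ?g (P y) * cnj (KK_inner ?g (P z)) - KK_inner ?u (P y) * cnj (KK_inner ?u (P z))) / ?d"
    if z: "z \<in> KK (A - {x})" and y: "y \<in> KK (A - {x})" for z y
  proof -
    have u: "?u \<in> KK A" and g: "?g \<in> KK A" and zA: "z \<in> KK A" and yA: "y \<in> KK A" and z_u: "KK_inner ?u z = 0"
      using z y by (simp_all add: ket_in_KK x KK_Diff_singleton_ket[where b = b])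
    have "KK_inner z (P ?g) = cnj (KK_inner ?g (P z))" "KK_inner z (P ?u) = cnj (KK_inner ?u (P z))"
      using Gr_sym[OF P g zA] Gr_sym[OF P u zA] by (metis KK_inner_commute)+
    moreover have "KK_inner z ?u = 0"
      using z_u KK_inner_commute[of z ?u] by simp
    ultimately have "KK_inner z (reduce_at P x b y) = KK_inner z (P y)
      - KK_inner ?g (P y) / ?d * cnj (KK_inner ?g (P z)) - KK_inner ?u (P y) / ?d * (0 - cnj (KK_inner ?u (P z)))"
      unfolding reduce_at_def using u g zA yA
      by (simp add: KK_inner_diff_right[where A = A] KK_inner_scale_right KK_closed Gr_closed[OF P])
    then show ?thesis
      by (simp add: diff_divide_distrib)
  qed
  have Psym: "KK_inner w (P v) = cnj (KK_inner v (P w))"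
    using Gr_sym[OF P, of v w] v w KK_inner_commute[of w "P v"] by (simp add: KK_Diff_singleton)
  have "KK_inner (reduce_at P x b v) w = cnj (KK_inner w (reduce_at P x b v))"
    by (rule KK_inner_commute)
  also have "\<dots> = KK_inner v (reduce_at P x b w)"
    by (simp add: formula v w Psym mult.commute)
  finally show ?thesis .
qed

lemma reduce_at_Gr: "reduce_at P x b \<in> Gr (A - {x})"
  unfolding Gr_def is_orth_projection_on_def
proof (intro CollectI conjI ballI allI)
  fix v assume v: "v \<in> KK (A - {x})"
  then have vA: "v \<in> KK A"
    by (simp add: KK_Diff_singleton)
  show red: "reduce_at P x b v \<in> KK (A - {x})"
    by (rule reduce_at_closed[OF v])
  show "reduce_at P x b (KK_scale c v) = KK_scale c (reduce_at P x b v)" for c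
    unfolding reduce_at_def Gr_scale[OF P vA] KK_inner_scale_right
    by (simp add: KK_scale_def prod_eq_iff fun_eq_iff algebra_simps)
  show "reduce_at P x b (reduce_at P x b v) = reduce_at P x b v"
    using reduce_at_in_range[OF vA] reduce_at_fixes red by blast
  show "Gamma (reduce_at P x b (Gamma v)) = v - reduce_at P x b v"
    by (rule reduce_at_Gamma[OF v])
  fix w assume w: "w \<in> KK (A - {x})"
  then have wA: "w \<in> KK A"
    by (simp add: KK_Diff_singleton)
  show "reduce_at P x b (v + w) = reduce_at P x b v + reduce_at P x b w"
    unfolding reduce_at_def Gr_add[OF P vA wA] KK_inner_ket_add
    by (simp add: KK_scale_def prod_eq_iff fun_eq_iff algebra_simps add_divide_distrib)
  show "KK_inner (reduce_at P x b v) w = KK_inner v (reduce_at P x b w)"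
    by (rule reduce_at_sym[OF v w])
qed

lemma reduce_at_range:
  "reduce_at P x b ` KK (A - {x}) = {p + KK_scale c (ket x b) |p c. p \<in> P ` KK A} \<inter> KK (A - {x})"
proof (intro equalityI subsetI)
  fix w assume "w \<in> reduce_at P x b ` KK (A - {x})"
  then obtain v where v: "v \<in> KK (A - {x})" "w = reduce_at P x b v"
    by blast
  then have "v \<in> KK A"
    by (simp add: KK_Diff_singleton)
  then show "w \<in> {p + KK_scale c (ket x b) |p c. p \<in> P ` KK A} \<inter> KK (A - {x})"
    using reduce_at_in_range reduce_at_closed[OF v(1)] unfolding v(2) by blast
next
  fix w assume w: "w \<in> {p + KK_scale c (ket x b) |p c. p \<in> P ` KK A} \<inter> KK (A - {x})"
  then have "reduce_at P x b w = w"
    using reduce_at_fixes by blast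
  then show "w \<in> reduce_at P x b ` KK (A - {x})"
    using w by (intro image_eqI[of w _ w]) auto
qed

end


section \<open>The kernel under reduction at one point\<close>

text \<open>
  The matrix kernel in coordinates: the row index \<open>(x, s)\<close> and the column index \<open>(y, t)\<close> name basis
  vectors, the entry is \<open>\<langle>\<Gamma> ket x s, P ket y t\<rangle>\<close>, and an identity is subtracted in the
  lower left corner of each diagonal block.
\<close>

definition kernel_entry :: "('a dvec \<Rightarrow> 'a dvec) \<Rightarrow> 'a \<Rightarrow> bool \<Rightarrow> 'a \<Rightarrow> bool \<Rightarrow> complex" where
  "kernel_entry P x s y t =
     KK_inner (ket x (\<not> s)) (P (ket y t)) - (if x = y \<and> \<not> s \<and> t then 1 else 0)"

lemma kernel_matrix_eq_entry:
  "kernel_matrix P xs i j = kernel_entry P (xs ! (i div 2)) (even i) (xs ! (j div 2)) (even j)"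
proof -
  have "i mod 2 = (if even i then 0 else 1)" "j mod 2 = (if even j then 0 else 1)"
    by presburger+
  then show ?thesis
    unfolding kernel_matrix_def kernel_block_def kernel_entry_def ell2_inner_unit_vec KK_inner_ket
    by (auto simp: ket_def unit_vec_def)
qed

lemma kernel_entry_antisym:
  assumes P: "P \<in> Gr A" and "x \<in> A" "y \<in> A"
  shows "kernel_entry P y t x s = - kernel_entry P x s y t"
  using Gr_antisymmetry[OF P, of "ket x s" "ket y t"] assms(2,3)
  by (auto simp: kernel_entry_def ket_in_KK KK_inner_ket_ket algebra_simps split: if_splits)

lemma kernel_matrix_antisym:
  assumes "P \<in> Gr A" "set xs \<subseteq> A"
  shows "antisym_upto (2 * length xs) (kernel_matrix P xs)"
  unfolding antisym_upto_def kernel_matrix_eq_entry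
proof (intro allI impI)
  fix i j assume "i < 2 * length xs" "j < 2 * length xs"
  then have "xs ! (i div 2) \<in> A" "xs ! (j div 2) \<in> A"
    using assms(2) by (auto intro!: subsetD[OF assms(2)] nth_mem)
  then show "kernel_entry P (xs ! (j div 2)) (even j) (xs ! (i div 2)) (even i)
      = - kernel_entry P (xs ! (i div 2)) (even i) (xs ! (j div 2)) (even j)"
    by (intro kernel_entry_antisym[OF assms(1)])
qed

lemma kernel_entry_reduce_at:
  assumes P: "P \<in> Gr A" and "x \<in> A" "y \<in> A" "z \<in> A" "y \<noteq> x"
  shows "kernel_entry (reduce_at P x b) y s z t = kernel_entry P y s z t
     - (KK_inner (ket x (\<not> b)) (P (ket z t)) * KK_inner (ket y (\<not> s)) (P (ket x (\<not> b)))
        - KK_inner (ket x b) (P (ket z t)) * KK_inner (ket y (\<not> s)) (P (ket x b))) / of_real (point_prob P x b)"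
  using assms by (simp add: kernel_entry_def reduce_at_def KK_inner_ket_diff KK_inner_ket_scale
      KK_inner_ket_ket diff_divide_distrib)

lemma kernel_matrix_Cons_shift:
  "kernel_matrix P (x # xs) (i + 2) (j + 2) = kernel_matrix P xs i j"
  by (simp add: kernel_matrix_eq_entry)

text \<open>
  The block of \<open>x\<close> has upper right entry \<open>d = point_prob P x True\<close>. If \<open>d \<noteq> 0\<close>, the Schur complement
  with respect to this block is the kernel of the reduced projection. If \<open>d = 0\<close>, then \<open>P\<close> annihilates
  \<open>ket x False\<close> and fixes \<open>ket x True\<close>, so the first row of the matrix vanishes.
\<close>

lemma pfaffian_kernel_occupied:
  assumes P: "P \<in> Gr A" and x: "x \<in> A" and xs: "set xs \<subseteq> A - {x}"
  shows "pfaffian (Suc (length xs)) (kernel_matrix P (x # xs))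
     = of_real (point_prob P x True) * pfaffian (length xs) (kernel_matrix (reduce_at P x True) xs)"
proof -
  let ?n = "length xs" and ?M = "kernel_matrix P (x # xs)"
  have anti: "antisym_upto (2 * ?n + 2) ?M"
    using kernel_matrix_antisym[OF P, of "x # xs"] x xs by (simp add: subset_Diff_insert)
  have M01: "?M 0 1 = of_real (point_prob P x True)"
    using KK_inner_Gamma_ket_P[OF P x, of True] by (simp add: kernel_matrix_eq_entry kernel_entry_def)
  have nth: "xs ! (i div 2) \<in> A" "xs ! (i div 2) \<noteq> x" if "i < 2 * ?n" for i
  proof -
    have "xs ! (i div 2) \<in> set xs"
      using that by (intro nth_mem) auto
    then show "xs ! (i div 2) \<in> A" "xs ! (i div 2) \<noteq> x"
      using xs by auto
  qed
  show ?thesis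
  proof (cases "point_prob P x True = 0")
    case True
    have "?M 0 j = 0" if "2 \<le> j" "j < 2 * ?n + 2" for j
    proof -
      define k where "k = j - 2"
      have k: "j = k + 2" "k < 2 * ?n"
        using that by (auto simp: k_def)
      have "kernel_entry P x True (xs ! (k div 2)) (even k) = - kernel_entry P (xs ! (k div 2)) (even k) x True"
        using nth[OF k(2)] x by (intro kernel_entry_antisym[OF P])
      also have "kernel_entry P (xs ! (k div 2)) (even k) x True = 0"
        using point_prob_eq_0[OF P x True] nth[OF k(2)] by (simp add: kernel_entry_def KK_inner_ket_ket)
      finally show ?thesis
        by (simp add: k kernel_matrix_eq_entry)
    qed
    then show ?thesis
      using pfaffian_clean_row[OF anti] True M01 by simp
  next
    case False
    have "pfaffian (Suc ?n) ?M = ?M 0 1 * pfaffian ?n (\<lambda>i j. ?M (i + 2) (j + 2)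
        - ?M 0 (j + 2) / ?M 0 1 * ?M (i + 2) 1 - ?M 0 (i + 2) / ?M 0 1 * ?M 1 (j + 2))"
      by (rule pfaffian_pivot[OF anti]) (simp only: M01 of_real_eq_0_iff False not_False_eq_True)
    also have "pfaffian ?n (\<lambda>i j. ?M (i + 2) (j + 2)
        - ?M 0 (j + 2) / ?M 0 1 * ?M (i + 2) 1 - ?M 0 (i + 2) / ?M 0 1 * ?M 1 (j + 2))
      = pfaffian ?n (kernel_matrix (reduce_at P x True) xs)"
    proof (rule pfaffian_cong)
      fix i j assume i: "i < 2 * ?n" and j: "j < 2 * ?n"
      let ?y = "xs ! (i div 2)" and ?z = "xs ! (j div 2)"
      have "?M 0 (i + 2) = - kernel_entry P ?y (even i) x True"
        using kernel_entry_antisym[OF P _ x, of ?y True "even i"] nth[OF i] by (simp add: kernel_matrix_eq_entry)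
      then show "?M (i + 2) (j + 2) - ?M 0 (j + 2) / ?M 0 1 * ?M (i + 2) 1 - ?M 0 (i + 2) / ?M 0 1 * ?M 1 (j + 2)
         = kernel_matrix (reduce_at P x True) xs i j"
        using nth[OF i] nth[OF j] x
        by (simp only: M01 kernel_matrix_Cons_shift, simp only: kernel_matrix_eq_entry
            kernel_entry_reduce_at[OF P x nth(1)[OF i] nth(1)[OF j] nth(2)[OF i]])
          (simp add: kernel_entry_def diff_divide_distrib)
    qed
    finally show ?thesis
      by (simp only: M01)
  qed
qed

text \<open>
  The left-hand side is minus the Pfaffian of the matrix in which the upper right entry of the block
  of \<open>x\<close>, \<open>1 - d\<close> with \<open>d = point_prob P x False\<close>, has been lowered to \<open>-d\<close>. With this pivot the
  Schur complement is again the kernel of the reduced projection: in comparison with an occupied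
  point the roles of \<open>u\<close> and \<open>\<Gamma>u\<close> are exchanged, and the sign of the pivot compensates for that.
\<close>

lemma pfaffian_kernel_vacant:
  assumes P: "P \<in> Gr A" and x: "x \<in> A" and xs: "set xs \<subseteq> A - {x}"
  shows "pfaffian (length xs) (kernel_matrix P xs) - pfaffian (Suc (length xs)) (kernel_matrix P (x # xs))
     = of_real (point_prob P x False) * pfaffian (length xs) (kernel_matrix (reduce_at P x False) xs)"
proof -
  let ?n = "length xs" and ?M = "kernel_matrix P (x # xs)"
  let ?L = "lower_first_pair ?M"
  have anti: "antisym_upto (2 * ?n + 2) ?M"
    using kernel_matrix_antisym[OF P, of "x # xs"] x xs by (simp add: subset_Diff_insert)
  have antiL: "antisym_upto (2 * ?n + 2) ?L"
    unfolding antisym_upto_def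
  proof (intro allI impI)
    fix i j assume "i < 2 * ?n + 2" "j < 2 * ?n + 2"
    from antisym_uptoD[OF anti this] show "?L j i = - ?L i j"
      by (simp add: lower_first_pair_def)
  qed
  have L: "pfaffian ?n (kernel_matrix P xs) - pfaffian (Suc ?n) ?M = - pfaffian (Suc ?n) ?L"
    using pfaffian_lower_first_pair[OF anti] by (simp only: kernel_matrix_Cons_shift) simp
  have L01: "?L 0 1 = - of_real (point_prob P x False)"
    using KK_inner_ket_P[OF P x, of False] by (simp add: lower_first_pair_def kernel_matrix_eq_entry kernel_entry_def)
  have L_eq: "?L (i + 2) j = ?M (i + 2) j" "?L i (j + 2) = ?M i (j + 2)" for i j
    by (auto simp: lower_first_pair_def)
  have nth: "xs ! (i div 2) \<in> A" "xs ! (i div 2) \<noteq> x" if "i < 2 * ?n" for i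
  proof -
    have "xs ! (i div 2) \<in> set xs"
      using that by (intro nth_mem) auto
    then show "xs ! (i div 2) \<in> A" "xs ! (i div 2) \<noteq> x"
      using xs by auto
  qed
  have M0: "?M 0 (i + 2) = - kernel_entry P (xs ! (i div 2)) (even i) x True" if "i < 2 * ?n" for i
    using kernel_entry_antisym[OF P _ x, of "xs ! (i div 2)" True "even i"] nth[OF that]
    by (simp add: kernel_matrix_eq_entry)
  show ?thesis
  proof (cases "point_prob P x False = 0")
    case True
    have "?L 0 j = 0" if "2 \<le> j" "j < 2 * ?n + 2" for j
    proof -
      define k where "k = j - 2"
      have k: "j = k + 2" "k < 2 * ?n"
        using that by (auto simp: k_def)
      show ?thesis
        using M0[OF k(2)] point_prob_eq_0[OF P x True] nth[OF k(2)] L_eq(2)[of 0 k]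
        by (simp add: k kernel_entry_def KK_inner_ket)
    qed
    then show ?thesis
      using pfaffian_clean_row[OF antiL] True L01 L by simp
  next
    case False
    have "pfaffian (Suc ?n) ?L = ?L 0 1 * pfaffian ?n (\<lambda>i j. ?L (i + 2) (j + 2)
        - ?L 0 (j + 2) / ?L 0 1 * ?L (i + 2) 1 - ?L 0 (i + 2) / ?L 0 1 * ?L 1 (j + 2))"
      by (rule pfaffian_pivot[OF antiL]) (simp only: L01 neg_equal_0_iff_equal of_real_eq_0_iff False not_False_eq_True)
    also have "pfaffian ?n (\<lambda>i j. ?L (i + 2) (j + 2)
        - ?L 0 (j + 2) / ?L 0 1 * ?L (i + 2) 1 - ?L 0 (i + 2) / ?L 0 1 * ?L 1 (j + 2))
      = pfaffian ?n (kernel_matrix (reduce_at P x False) xs)"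
    proof (rule pfaffian_cong)
      fix i j assume i: "i < 2 * ?n" and j: "j < 2 * ?n"
      show "?L (i + 2) (j + 2) - ?L 0 (j + 2) / ?L 0 1 * ?L (i + 2) 1 - ?L 0 (i + 2) / ?L 0 1 * ?L 1 (j + 2)
         = kernel_matrix (reduce_at P x False) xs i j"
        using nth[OF i] nth[OF j] x M0[OF i]
        by (simp only: L01 L_eq kernel_matrix_Cons_shift, simp only: kernel_matrix_eq_entry
            kernel_entry_reduce_at[OF P x nth(1)[OF i] nth(1)[OF j] nth(2)[OF i]])
          (simp add: kernel_entry_def diff_divide_distrib)
    qed
    finally show ?thesis
      by (simp only: L L01 mult_minus_left minus_minus)
  qed
qed


section \<open>The \<open>\<sigma>\<close>-algebra of configurations\<close>

lemma space_Omega [simp]: "space (Omega A) = Pow A"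
  unfolding Omega_def by (rule space_measure_of) (auto simp: Omega_topology_def openin_pullback_topology)

lemma sets_Omega_openin: "sets (Omega A) = sigma_sets (Pow A) {U. openin (Omega_topology A) U}"
  unfolding Omega_def by (rule sets_measure_of) (auto simp: Omega_topology_def openin_pullback_topology)

lemma openin_Omega_cylinder:
  assumes "finite F" "F \<subseteq> A"
  shows "openin (Omega_topology A) (cylinder A F {})"
proof -
  define W where "W x = (if x \<in> F then {True} else UNIV)" for x
  have "finite {x \<in> A. W x \<noteq> UNIV}"
    by (rule finite_subset[OF _ assms(1)]) (auto simp: W_def)
  then have "openin (product_topology (\<lambda>_. discrete_topology (UNIV :: bool set)) A) (\<Pi>\<^sub>E x\<in>A. W x)"
    by (subst openin_PiE_gen) auto
  moreover have "cylinder A F {} = (\<lambda>\<omega>. \<lambda>x\<in>A. x \<in> \<omega>) -` (\<Pi>\<^sub>E x\<in>A. W x) \<inter> Pow A"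
    using assms(2) by (auto simp: cylinder_def W_def PiE_iff split: if_splits)
  ultimately show ?thesis
    unfolding Omega_topology_def openin_pullback_topology by blast
qed

text \<open>
  A basic open set of the product topology constrains finitely many points, and \<open>\<omega>\<close> itself says
  which of them to require and which to forbid.
\<close>

lemma openin_Omega_contains_cylinder:
  assumes "openin (Omega_topology A) U" "\<omega> \<in> U"
  shows "\<exists>Y Z. finite Y \<and> finite Z \<and> Y \<subseteq> A \<and> Z \<subseteq> A \<and> \<omega> \<in> cylinder A Y Z \<and> cylinder A Y Z \<subseteq> U"
proof -
  let ?ind = "\<lambda>\<omega>. \<lambda>x\<in>A. x \<in> \<omega>"
  obtain V where V: "openin (product_topology (\<lambda>_. discrete_topology (UNIV :: bool set)) A) V"
    and U: "U = ?ind -` V \<inter> Pow A"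
    using assms(1) unfolding Omega_topology_def openin_pullback_topology by blast
  have "?ind \<omega> \<in> V"
    using assms(2) U by auto
  then obtain W where W: "finite {x \<in> A. W x \<noteq> (UNIV :: bool set)}" "?ind \<omega> \<in> (\<Pi>\<^sub>E x\<in>A. W x)" "(\<Pi>\<^sub>E x\<in>A. W x) \<subseteq> V"
    using V unfolding openin_product_topology_alt by auto
  define F where "F = {x \<in> A. W x \<noteq> UNIV}"
  have F: "finite F" "F \<subseteq> A"
    using W(1) by (auto simp: F_def)
  have "cylinder A (F \<inter> \<omega>) (F - \<omega>) \<subseteq> U"
  proof
    fix \<omega>' assume \<omega>': "\<omega>' \<in> cylinder A (F \<inter> \<omega>) (F - \<omega>)"
    have "(x \<in> \<omega>') \<in> W x" if "x \<in> A" for x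
    proof (cases "x \<in> F")
      case True
      then have "(x \<in> \<omega>') = (x \<in> \<omega>)"
        using \<omega>' by (auto simp: cylinder_def)
      then show ?thesis
        using W(2) that by (auto simp: PiE_iff)
    next
      case False
      then show ?thesis
        using that by (auto simp: F_def)
    qed
    then have "?ind \<omega>' \<in> (\<Pi>\<^sub>E x\<in>A. W x)"
      by auto
    then have "?ind \<omega>' \<in> V"
      using W(3) by blast
    then show "\<omega>' \<in> U"
      using \<omega>' by (auto simp: U cylinder_def)
  qed
  moreover have "\<omega> \<in> cylinder A (F \<inter> \<omega>) (F - \<omega>)"
    using assms(2) U by (auto simp: cylinder_def)
  ultimately show ?thesis
    using F by (intro exI[of _ "F \<inter> \<omega>"] exI[of _ "F - \<omega>"]) auto
qed

definition occupation_events :: "'a set \<Rightarrow> 'a set set set" where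
  "occupation_events A = {cylinder A F {} |F. finite F \<and> F \<subseteq> A}"

lemma occupation_eventsI: "finite F \<Longrightarrow> F \<subseteq> A \<Longrightarrow> cylinder A F {} \<in> occupation_events A"
  by (auto simp: occupation_events_def)

lemma occupation_events_subset: "occupation_events A \<subseteq> Pow (Pow A)"
  by (auto simp: occupation_events_def cylinder_def)

lemma cylinder_split:
  "cylinder A Y (insert z Z) = cylinder A Y Z - cylinder A (insert z Y) Z"
  by (auto simp: cylinder_def)

lemma cylinder_in_algebra:
  assumes "\<And>F. finite F \<Longrightarrow> F \<subseteq> A \<Longrightarrow> cylinder A F {} \<in> \<M>" "algebra (Pow A) \<M>"
    and "finite Z" "finite Y" "Y \<subseteq> A" "Z \<subseteq> A"
  shows "cylinder A Y Z \<in> \<M>"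
  using assms(3-)
proof (induction Z arbitrary: Y)
  case empty
  then show ?case using assms(1) by simp
next
  case (insert z Z)
  interpret algebra "Pow A" \<M> by fact
  show ?case
    unfolding cylinder_split using insert by (intro Diff) auto
qed

text \<open>
  Over a countable set there are only countably many finite cylinders, so every open set is a
  countable union of them.
\<close>

lemma sets_Omega:
  assumes "countable A"
  shows "sets (Omega A) = sigma_sets (Pow A) (occupation_events A)"
proof -
  interpret sigma_algebra "Pow A" "sigma_sets (Pow A) (occupation_events A)"
    by (rule sigma_algebra_sigma_sets[OF occupation_events_subset])
  have "U \<in> sigma_sets (Pow A) (occupation_events A)" if U: "openin (Omega_topology A) U" for U
  proof -
    define I where "I = {(Y, Z). finite Y \<and> finite Z \<and> Y \<subseteq> A \<and> Z \<subseteq> A \<and> cylinder A Y Z \<subseteq> U}"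
    have "I \<subseteq> {Y. finite Y \<and> Y \<subseteq> A} \<times> {Z. finite Z \<and> Z \<subseteq> A}"
      by (auto simp: I_def)
    then have "countable I"
      by (rule countable_subset) (intro countable_SIGMA countable_Collect_finite_subset assms)
    moreover have "cylinder A Y Z \<in> sigma_sets (Pow A) (occupation_events A)" if "(Y, Z) \<in> I" for Y Z
      using that
      by (intro cylinder_in_algebra[OF sigma_sets.Basic[OF occupation_eventsI] algebra_axioms])
        (auto simp: I_def)
    moreover have "U = (\<Union>(Y, Z)\<in>I. cylinder A Y Z)"
    proof (intro equalityI subsetI)
      fix \<omega> assume "\<omega> \<in> U"
      from openin_Omega_contains_cylinder[OF U this] obtain Y Z
        where "(Y, Z) \<in> I" "\<omega> \<in> cylinder A Y Z"
        unfolding I_def by blast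
      then show "\<omega> \<in> (\<Union>(Y, Z)\<in>I. cylinder A Y Z)"
        by blast
    qed (auto simp: I_def)
    ultimately show ?thesis
      by (auto intro!: countable_UN')
  qed
  then have "sigma_sets (Pow A) {U. openin (Omega_topology A) U} \<subseteq> sigma_sets (Pow A) (occupation_events A)"
    by (intro sigma_sets_mono) auto
  moreover have "sigma_sets (Pow A) (occupation_events A) \<subseteq> sigma_sets (Pow A) {U. openin (Omega_topology A) U}"
    by (intro sigma_sets_mono) (auto simp: occupation_events_def openin_Omega_cylinder)
  ultimately show ?thesis
    unfolding sets_Omega_openin by auto
qed

lemma cylinder_in_sets_Omega:
  assumes "countable A" "finite Y" "finite Z" "Y \<subseteq> A" "Z \<subseteq> A"
  shows "cylinder A Y Z \<in> sets (Omega A)"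
proof (rule cylinder_in_algebra)
  show "algebra (Pow A) (sets (Omega A))"
    using sets.algebra_axioms[of "Omega A"] by simp
qed (use assms in \<open>auto simp: sets_Omega intro: occupation_eventsI\<close>)

lemma measurable_into_Omega:
  assumes "countable A" "f \<in> space M \<rightarrow> Pow A"
    and "\<And>F. finite F \<Longrightarrow> F \<subseteq> A \<Longrightarrow> {m \<in> space M. F \<subseteq> f m} \<in> sets M"
  shows "f \<in> measurable M (Omega A)"
proof (rule measurable_sigma_sets[OF sets_Omega[OF assms(1)] occupation_events_subset assms(2)])
  fix E assume "E \<in> occupation_events A"
  then obtain F where F: "finite F" "F \<subseteq> A" "E = cylinder A F {}"
    by (auto simp: occupation_events_def)
  have "f -` E \<inter> space M = {m \<in> space M. F \<subseteq> f m}"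
    using assms(2) by (auto simp: F(3) cylinder_def)
  then show "f -` E \<inter> space M \<in> sets M"
    using assms(3)[OF F(1,2)] by simp
qed

lemma Omega_measure_eqI:
  assumes A: "countable A" and M: "sets M = sets (Omega A)" "prob_space M" and N: "sets N = sets (Omega A)"
    and eq: "\<And>F. finite F \<Longrightarrow> F \<subseteq> A \<Longrightarrow> emeasure M (cylinder A F {}) = emeasure N (cylinder A F {})"
  shows "M = N"
proof (rule measure_eqI_generator_eq[where \<Omega> = "Pow A" and E = "occupation_events A" and A = "\<lambda>_::nat. Pow A"])
  show "Int_stable (occupation_events A)"
  proof (rule Int_stableI)
    fix C D assume "C \<in> occupation_events A" "D \<in> occupation_events A"
    then obtain F G where "finite F" "F \<subseteq> A" "C = cylinder A F {}" "finite G" "G \<subseteq> A" "D = cylinder A G {}"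
      by (auto simp: occupation_events_def)
    moreover have "cylinder A F {} \<inter> cylinder A G {} = cylinder A (F \<union> G) {}"
      by (auto simp: cylinder_def)
    ultimately show "C \<inter> D \<in> occupation_events A"
      by (auto intro!: occupation_eventsI)
  qed
  have "Pow A = cylinder A {} {}"
    by (auto simp: cylinder_def)
  then show "range (\<lambda>_::nat. Pow A) \<subseteq> occupation_events A"
    by (auto intro!: occupation_eventsI)
  interpret prob_space M by fact
  show "emeasure M (Pow A) \<noteq> \<infinity>" for i :: nat
    by simp
next
  fix C assume "C \<in> occupation_events A"
  then show "emeasure M C = emeasure N C"
    using eq by (auto simp: occupation_events_def)
qed (use M N in \<open>simp_all add: sets_Omega[OF A] occupation_events_subset\<close>)


section \<open>Measures with prescribed correlations\<close>

text \<open>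
  The probability of \<open>cylinder A Y Z\<close> as inclusion and exclusion computes it from the correlations
  \<open>\<rho> F = \<P>(F \<subseteq> \<omega>)\<close>.
\<close>

definition cyl_weight :: "('a set \<Rightarrow> real) \<Rightarrow> 'a set \<Rightarrow> 'a set \<Rightarrow> real" where
  "cyl_weight \<rho> Y Z = (\<Sum>W\<in>Pow Z. (- 1) ^ card W * \<rho> (Y \<union> W))"

lemma cyl_weight_empty [simp]: "cyl_weight \<rho> Y {} = \<rho> Y"
  by (simp add: cyl_weight_def)

lemma cyl_weight_insert_alt:
  assumes "finite Z" "z \<notin> Z"
  shows "cyl_weight \<rho> Y (insert z Z) = (\<Sum>W\<in>Pow Z. (- 1) ^ card W * (\<rho> (Y \<union> W) - \<rho> (insert z (Y \<union> W))))"
proof -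
  have "cyl_weight \<rho> Y (insert z Z) = (\<Sum>W\<in>Pow Z. (- 1) ^ card W * \<rho> (Y \<union> W))
      + (\<Sum>W\<in>insert z ` Pow Z. (- 1) ^ card W * \<rho> (Y \<union> W))"
    unfolding cyl_weight_def Pow_insert using assms by (intro sum.union_disjoint) auto
  also have "(\<Sum>W\<in>insert z ` Pow Z. (- 1) ^ card W * \<rho> (Y \<union> W))
      = (\<Sum>W\<in>Pow Z. (- 1) ^ card (insert z W) * \<rho> (Y \<union> insert z W))"
    using assms by (subst sum.reindex) (auto simp: inj_on_def)
  also have "\<dots> = (\<Sum>W\<in>Pow Z. - ((- 1) ^ card W * \<rho> (insert z (Y \<union> W))))"
  proof (intro sum.cong refl)
    fix W assume "W \<in> Pow Z"
    then have "card (insert z W) = Suc (card W)"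
      using assms by (intro card_insert_disjoint) (auto dest: finite_subset)
    then show "(- 1) ^ card (insert z W) * \<rho> (Y \<union> insert z W) = - ((- 1) ^ card W * \<rho> (insert z (Y \<union> W)))"
      by simp
  qed
  finally show ?thesis
    by (simp add: sum.distrib[symmetric] sum_negf sum_subtractf algebra_simps)
qed

lemma cyl_weight_insert:
  assumes "finite Z" "z \<notin> Z"
  shows "cyl_weight \<rho> Y (insert z Z) = cyl_weight \<rho> Y Z - cyl_weight \<rho> (insert z Y) Z"
  unfolding cyl_weight_insert_alt[OF assms]
  by (simp add: cyl_weight_def right_diff_distrib sum_subtractf)

text \<open>
  Summing over all ways to decide the points of \<open>K\<close> forgets \<open>K\<close>. This is the consistency of the
  finite-dimensional distributions.
\<close>

lemma sum_cyl_weight_completions: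
  assumes "finite K" "finite Y" "finite Z" "Y \<inter> K = {}" "Z \<inter> K = {}"
  shows "(\<Sum>T\<in>Pow K. cyl_weight \<rho> (Y \<union> T) (Z \<union> (K - T))) = cyl_weight \<rho> Y Z"
  using assms
proof (induction K arbitrary: Y Z)
  case (insert x K)
  let ?c = "cyl_weight \<rho>"
  have "(\<Sum>T\<in>Pow (insert x K). ?c (Y \<union> T) (Z \<union> (insert x K - T)))
      = (\<Sum>T\<in>Pow K. ?c (Y \<union> T) (Z \<union> (insert x K - T)))
        + (\<Sum>T\<in>insert x ` Pow K. ?c (Y \<union> T) (Z \<union> (insert x K - T)))"
    unfolding Pow_insert using insert.hyps by (intro sum.union_disjoint) auto
  also have "(\<Sum>T\<in>insert x ` Pow K. ?c (Y \<union> T) (Z \<union> (insert x K - T)))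
      = (\<Sum>T\<in>Pow K. ?c (Y \<union> insert x T) (Z \<union> (insert x K - insert x T)))"
    using insert.hyps by (subst sum.reindex) (auto simp: inj_on_def)
  also have "\<dots> = (\<Sum>T\<in>Pow K. ?c (insert x Y \<union> T) (Z \<union> (K - T)))"
    using insert.hyps by (intro sum.cong refl arg_cong2[where f = ?c]) auto
  also have "\<dots> = ?c (insert x Y) Z"
    using insert.prems insert.hyps by (intro insert.IH) auto
  also have "(\<Sum>T\<in>Pow K. ?c (Y \<union> T) (Z \<union> (insert x K - T))) = (\<Sum>T\<in>Pow K. ?c (Y \<union> T) (insert x Z \<union> (K - T)))"
    using insert.hyps by (intro sum.cong refl arg_cong2[where f = ?c]) auto
  also have "\<dots> = ?c Y (insert x Z)"
    using insert.prems insert.hyps by (intro insert.IH) auto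
  also have "?c Y (insert x Z) + ?c (insert x Y) Z = ?c Y Z"
    using insert.prems by (simp add: cyl_weight_insert)
  finally show ?case .
qed simp

text \<open>
  On a finite set \<open>J\<close> the weights \<open>cyl_weight \<rho> \<eta> (J - \<eta>)\<close> define a probability distribution of the
  trace of the configuration on \<open>J\<close>. These distributions are consistent, so Kolmogorov's extension
  theorem applies to their images under the indicator map.
\<close>

lemma ex_measure_with_correlations:
  fixes \<rho> :: "'a set \<Rightarrow> real"
  assumes A: "countable A" and empty: "\<rho> {} = 1"
    and nonneg: "\<And>Y Z. finite Y \<Longrightarrow> finite Z \<Longrightarrow> Y \<subseteq> A \<Longrightarrow> Z \<subseteq> A \<Longrightarrow> Y \<inter> Z = {} \<Longrightarrow> 0 \<le> cyl_weight \<rho> Y Z"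
  shows "\<exists>M. prob_space M \<and> sets M = sets (Omega A) \<and>
    (\<forall>F. finite F \<and> F \<subseteq> A \<longrightarrow> measure M (cylinder A F {}) = \<rho> F)"
proof -
  \<comment> \<open>Outside the relevant arguments the value \<open>0\<close> keeps \<open>g J\<close> a mass function.\<close>
  define g where "g J \<eta> = (if finite J \<and> J \<subseteq> A \<and> \<eta> \<subseteq> J then cyl_weight \<rho> \<eta> (J - \<eta>) else 0)" for J \<eta>
  define p where "p J = embed_pmf (g J)" for J
  have pmf_p: "pmf (p J) \<eta> = cyl_weight \<rho> \<eta> (J - \<eta>)" and set_p: "set_pmf (p J) \<subseteq> Pow J"
    if J: "finite J" "J \<subseteq> A" and \<eta>: "\<eta> \<subseteq> J" for J \<eta>
  proof -
    have g_nonneg: "0 \<le> g J \<eta>" for \<eta>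
      unfolding g_def by (auto intro!: nonneg dest: finite_subset)
    have "(\<integral>\<^sup>+\<eta>. ennreal (g J \<eta>) \<partial>count_space UNIV) = (\<Sum>\<eta>\<in>Pow J. ennreal (g J \<eta>))"
      using J by (intro nn_integral_count_space') (auto simp: g_def)
    also have "\<dots> = ennreal (\<Sum>\<eta>\<in>Pow J. g J \<eta>)"
      using g_nonneg by (intro sum_ennreal)
    also have "(\<Sum>\<eta>\<in>Pow J. g J \<eta>) = 1"
      using sum_cyl_weight_completions[of J "{}" "{}" \<rho>] J by (simp add: g_def empty)
    finally have total: "(\<integral>\<^sup>+\<eta>. ennreal (g J \<eta>) \<partial>count_space UNIV) = 1"
      by simp
    show "pmf (p J) \<eta> = cyl_weight \<rho> \<eta> (J - \<eta>)"
      unfolding p_def by (subst pmf_embed_pmf[OF g_nonneg total]) (use J \<eta> in \<open>simp add: g_def\<close>)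
    show "set_pmf (p J) \<subseteq> Pow J"
      unfolding p_def by (subst set_embed_pmf[OF g_nonneg total]) (auto simp: g_def split: if_splits)
  qed
  have map_p: "map_pmf (\<lambda>\<eta>. \<eta> \<inter> J) (p H) = p J" if JH: "J \<subseteq> H" and H: "finite H" "H \<subseteq> A" for J H
  proof (rule pmf_eqI)
    fix \<eta>
    have J: "finite J" "J \<subseteq> A"
      using JH H by (auto dest: finite_subset)
    show "pmf (map_pmf (\<lambda>\<eta>. \<eta> \<inter> J) (p H)) \<eta> = pmf (p J) \<eta>"
    proof (cases "\<eta> \<subseteq> J")
      case False
      then have "\<eta> \<notin> set_pmf (p J)" "\<eta> \<notin> set_pmf (map_pmf (\<lambda>\<eta>. \<eta> \<inter> J) (p H))"
        using set_p[OF J, of "{}"] by auto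
      then show ?thesis
        by (simp only: pmf_eq_0_set_pmf[symmetric])
    next
      case True
      have "pmf (map_pmf (\<lambda>\<eta>. \<eta> \<inter> J) (p H)) \<eta> = measure (p H) ((\<lambda>\<eta>. \<eta> \<inter> J) -` {\<eta>})"
        by (rule pmf_map)
      also have "\<dots> = measure (p H) ((\<lambda>\<eta>. \<eta> \<inter> J) -` {\<eta>} \<inter> set_pmf (p H))"
        by (rule measure_Int_set_pmf[symmetric])
      also have "\<dots> = measure (p H) ((\<lambda>T. \<eta> \<union> T) ` Pow (H - J) \<inter> set_pmf (p H))"
      proof (rule arg_cong[where f = "measure (p H)"])
        have "\<eta>' \<in> (\<lambda>T. \<eta> \<union> T) ` Pow (H - J)" if "\<eta>' \<in> set_pmf (p H)" "\<eta>' \<inter> J = \<eta>" for \<eta>'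
          using that set_p[OF H, of "{}"] by (intro image_eqI[of _ _ "\<eta>' - J"]) auto
        then show "(\<lambda>\<eta>. \<eta> \<inter> J) -` {\<eta>} \<inter> set_pmf (p H) = (\<lambda>T. \<eta> \<union> T) ` Pow (H - J) \<inter> set_pmf (p H)"
          using True by auto
      qed
      also have "\<dots> = measure (p H) ((\<lambda>T. \<eta> \<union> T) ` Pow (H - J))"
        by (rule measure_Int_set_pmf)
      also have "\<dots> = (\<Sum>\<eta>'\<in>(\<lambda>T. \<eta> \<union> T) ` Pow (H - J). pmf (p H) \<eta>')"
        using H by (intro measure_measure_pmf_finite) auto
      also have "\<dots> = (\<Sum>T\<in>Pow (H - J). pmf (p H) (\<eta> \<union> T))"
        using True by (subst sum.reindex) (auto simp: inj_on_def)
      also have "\<dots> = (\<Sum>T\<in>Pow (H - J). cyl_weight \<rho> (\<eta> \<union> T) ((J - \<eta>) \<union> ((H - J) - T)))"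
      proof (intro sum.cong refl)
        fix T assume "T \<in> Pow (H - J)"
        then have "\<eta> \<union> T \<subseteq> H" "H - (\<eta> \<union> T) = (J - \<eta>) \<union> ((H - J) - T)"
          using True JH by auto
        then show "pmf (p H) (\<eta> \<union> T) = cyl_weight \<rho> (\<eta> \<union> T) ((J - \<eta>) \<union> ((H - J) - T))"
          using pmf_p[OF H] by metis
      qed
      also have "\<dots> = cyl_weight \<rho> \<eta> (J - \<eta>)"
        using H J True by (intro sum_cyl_weight_completions) (auto dest: finite_subset)
      also have "\<dots> = pmf (p J) \<eta>"
        using pmf_p[OF J True] by simp
      finally show ?thesis .
    qed
  qed
  \<comment> \<open>Indicators take values in the reals, since the extension theorem is for Polish spaces.\<close>
  define ind where "ind J \<omega> = (\<lambda>x\<in>J. if x \<in> \<omega> then 1 else 0 :: real)" for J and \<omega> :: "'a set"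
  define PJ where "PJ J = distr (measure_pmf (p J)) (PiM J (\<lambda>_. borel)) (ind J)" for J
  have ind_meas: "ind J \<in> measurable (measure_pmf q) (PiM J (\<lambda>_. borel))" for J q
    by (auto simp: ind_def space_PiM)
  interpret polish_projective A PJ
  proof (intro polish_projective.intro projective_family.intro)
    fix J H assume JH: "J \<subseteq> H" and H: "finite H" "H \<subseteq> A"
    have "distr (PJ H) (PiM J (\<lambda>_. borel)) (\<lambda>f. restrict f J)
        = distr (measure_pmf (p H)) (PiM J (\<lambda>_. borel)) ((\<lambda>f. restrict f J) \<circ> ind H)"
      unfolding PJ_def by (rule distr_distr[OF measurable_restrict_subset[OF JH] ind_meas])
    also have "(\<lambda>f. restrict f J) \<circ> ind H = ind J \<circ> (\<lambda>\<eta>. \<eta> \<inter> J)"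
      using JH by (auto simp: ind_def fun_eq_iff)
    also have "distr (measure_pmf (p H)) (PiM J (\<lambda>_. borel)) (ind J \<circ> (\<lambda>\<eta>. \<eta> \<inter> J))
        = distr (distr (measure_pmf (p H)) (count_space UNIV) (\<lambda>\<eta>. \<eta> \<inter> J)) (PiM J (\<lambda>_. borel)) (ind J)"
      by (rule distr_distr[symmetric]) (auto simp: ind_def space_PiM)
    also have "\<dots> = PJ J"
      unfolding map_pmf_rep_eq[symmetric] map_p[OF JH H] PJ_def ..
    finally show "PJ J = distr (PJ H) (PiM J (\<lambda>_. borel)) (\<lambda>f. restrict f J)" ..
  next
    fix J show "prob_space (PJ J)"
      unfolding PJ_def by (rule measure_pmf.prob_space_distr[OF ind_meas])
  qed
  define occ where "occ f = {x \<in> A. f x = (1::real)}" for f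
  have occ_meas: "occ \<in> measurable lim (Omega A)"
  proof (rule measurable_into_Omega[OF A])
    fix F assume F: "finite F" "F \<subseteq> A"
    have "{f \<in> space lim. F \<subseteq> occ f} = {f \<in> space lim. \<forall>x\<in>F. f x = 1}"
      using F(2) by (auto simp: occ_def)
    also have "\<dots> \<in> sets lim"
    proof (rule sets.sets_Collect_finite_All[OF _ F(1)])
      fix x assume "x \<in> F"
      then have "(\<lambda>f. f x) \<in> measurable lim (borel :: real measure)"
        unfolding measurable_cong_sets[OF sets_lim refl] using F(2)
        by (intro measurable_component_singleton) auto
      from measurable_sets[OF this, of "{1}"] show "{f \<in> space lim. f x = 1} \<in> sets lim"
        by (simp add: vimage_def Int_def conj_commute)
    qed
    finally show "{f \<in> space lim. F \<subseteq> occ f} \<in> sets lim" .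
  qed (auto simp: occ_def)
  define M where "M = distr lim (Omega A) occ"
  have "measure M (cylinder A F {}) = \<rho> F" if F: "finite F" "F \<subseteq> A" for F
  proof -
    let ?X = "\<Pi>\<^sub>E x\<in>F. {1::real}"
    have X: "?X \<in> sets (PiM F (\<lambda>_. borel))"
      using F by (intro sets_PiM_I_finite) auto
    have "measure M (cylinder A F {}) = measure lim (occ -` cylinder A F {} \<inter> space lim)"
      unfolding M_def using cylinder_in_sets_Omega[OF A F(1) _ F(2)] by (intro measure_distr occ_meas) auto
    also have "occ -` cylinder A F {} \<inter> space lim = prod_emb A (\<lambda>_. borel) F ?X"
      using F by (subst prod_emb_PiE) (auto simp: occ_def cylinder_def space_PiM PiE_iff split: if_splits)
    also have "measure lim \<dots> = measure (PJ F) ?X"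
      by (rule measure_lim_emb[OF F(2,1) X])
    also have "\<dots> = measure (p F) (ind F -` ?X \<inter> space (measure_pmf (p F)))"
      unfolding PJ_def by (rule measure_distr[OF ind_meas X])
    also have "ind F -` ?X \<inter> space (measure_pmf (p F)) = {\<eta>. F \<subseteq> \<eta>}"
      unfolding ind_def vimage_def PiE_iff by (auto split: if_splits)
    also have "measure (p F) {\<eta>. F \<subseteq> \<eta>} = measure (p F) ({\<eta>. F \<subseteq> \<eta>} \<inter> set_pmf (p F))"
      by (rule measure_Int_set_pmf[symmetric])
    also have "{\<eta>. F \<subseteq> \<eta>} \<inter> set_pmf (p F) = {F} \<inter> set_pmf (p F)"
      using set_p[OF F, of "{}"] by auto
    also have "measure (p F) \<dots> = measure (p F) {F}"
      by (rule measure_Int_set_pmf)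
    also have "\<dots> = \<rho> F"
      using pmf_p[OF F, of F] by (simp add: measure_pmf_single)
    finally show ?thesis .
  qed
  moreover have "prob_space M"
    unfolding M_def by (rule P.prob_space_distr[OF occ_meas])
  moreover have "sets M = sets (Omega A)"
    by (simp add: M_def)
  ultimately show ?thesis
    by blast
qed


section \<open>Correlations and cylinder weights of a projection\<close>

lemma pfaffian_kernel_reorder:
  assumes "mset xs = mset ys"
  shows "pfaffian (length xs) (kernel_matrix P xs) = pfaffian (length ys) (kernel_matrix P ys)"
proof -
  obtain p where p: "p permutes {..<length ys}" "permute_list p ys = xs"
    using mset_eq_permutation[OF assms] .
  have len: "length xs = length ys"
    using p(2) by auto
  have nth: "xs ! i = ys ! p i" if "i < length ys" for i
    using permute_list_nth[OF p(1)] that p(2) by metis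
  have "kernel_matrix P xs i j = kernel_matrix P ys (on_pairs p i) (on_pairs p j)"
    if "i < 2 * length ys" "j < 2 * length ys" for i j
  proof -
    have "i div 2 < length ys" "j div 2 < length ys"
      using that by auto
    moreover have "on_pairs p k div 2 = p (k div 2)" "even (on_pairs p k) = even k" for k
      by (auto simp: on_pairs_def)
    ultimately show ?thesis
      by (simp add: kernel_matrix_eq_entry nth)
  qed
  then have "pfaffian (length ys) (kernel_matrix P xs)
      = pfaffian (length ys) (\<lambda>i j. kernel_matrix P ys (on_pairs p i) (on_pairs p j))"
    by (intro pfaffian_cong)
  also have "\<dots> = pfaffian (length ys) (kernel_matrix P ys)"
    using on_pairs_permutes[OF p(1)] by (simp add: pfaffian_relabel)
  finally show ?thesis
    by (simp add: len)
qed

text \<open>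
  Peeling off one point at a time writes the Pfaffian as a product of one-point probabilities of
  successively reduced projections.
\<close>

lemma pfaffian_kernel_nonneg:
  assumes "P \<in> Gr A" "distinct xs" "set xs \<subseteq> A"
  shows "pfaffian (length xs) (kernel_matrix P xs) \<in> \<real>\<^sub>\<ge>\<^sub>0"
  using assms
proof (induction xs arbitrary: A P)
  case Nil
  show ?case
    by (simp add: pfaffian_def)
next
  case (Cons x xs)
  have x: "x \<in> A" and xs: "set xs \<subseteq> A - {x}" "distinct xs"
    using Cons.prems by auto
  have step: "pfaffian (length (x # xs)) (kernel_matrix P (x # xs))
     = of_real (point_prob P x True) * pfaffian (length xs) (kernel_matrix (reduce_at P x True) xs)"
    using pfaffian_kernel_occupied[OF Cons.prems(1) x xs(1)] by simp
  show ?case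
  proof (cases "point_prob P x True = 0")
    case False
    have "reduce_at P x True \<in> Gr (A - {x})"
      by (rule reduce_at_Gr[OF Cons.prems(1) x False])
    then have "pfaffian (length xs) (kernel_matrix (reduce_at P x True) xs) \<in> \<real>\<^sub>\<ge>\<^sub>0"
      using Cons.IH xs by blast
    then show ?thesis
      unfolding step using point_prob_nonneg[OF Cons.prems(1) x, of True]
      by (intro nonneg_Reals_mult_I) auto
  qed (simp only: step, simp)
qed

text \<open>
  The enumeration of \<open>S\<close> may be arbitrary, because the Pfaffian of a kernel is invariant under
  reordering the points.
\<close>

definition corr :: "('a dvec \<Rightarrow> 'a dvec) \<Rightarrow> 'a set \<Rightarrow> real" where
  "corr P S = Re (pfaffian (card S) (kernel_matrix P (SOME xs. distinct xs \<and> set xs = S)))"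

lemma pfaffian_eq_corr:
  assumes P: "P \<in> Gr A" and xs: "distinct xs" "set xs \<subseteq> A"
  shows "pfaffian (length xs) (kernel_matrix P xs) = of_real (corr P (set xs))"
proof -
  define ys where "ys = (SOME ys. distinct ys \<and> set ys = set xs)"
  have ys: "distinct ys \<and> set ys = set xs"
    unfolding ys_def by (rule someI[of _ xs]) (simp add: xs)
  have "mset xs = mset ys"
    using ys xs by (simp add: set_eq_iff_mset_eq_distinct[symmetric])
  moreover have "length ys = card (set xs)"
    using ys by (metis distinct_card)
  ultimately have "pfaffian (length xs) (kernel_matrix P xs) = pfaffian (card (set xs)) (kernel_matrix P ys)"
    using pfaffian_kernel_reorder by metis
  moreover have "pfaffian (length xs) (kernel_matrix P xs) \<in> \<real>"
    using pfaffian_kernel_nonneg[OF P xs] nonneg_Reals_subset_Reals by blast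
  ultimately show ?thesis
    by (metis corr_def ys_def of_real_Re)
qed

lemma corr_empty [simp]: "corr P {} = 1"
  by (simp add: corr_def pfaffian_def)

text \<open>
  If \<open>point_prob P x b = 0\<close>, the reduced operator need not belong to the Grassmannian, but both
  sides are then \<open>0\<close>.
\<close>

lemma corr_one_point:
  assumes P: "P \<in> Gr A" and x: "x \<in> A" and S: "finite S" "S \<subseteq> A - {x}"
  shows corr_insert: "corr P (insert x S) = point_prob P x True * corr (reduce_at P x True) S"
    and corr_diff: "corr P S - corr P (insert x S) = point_prob P x False * corr (reduce_at P x False) S"
proof -
  obtain xs where xs: "distinct xs" "set xs = S"
    using finite_distinct_list[OF S(1)] by blast
  have x_xs: "distinct (x # xs)" "set (x # xs) \<subseteq> A" and xs_A: "set xs \<subseteq> A" "set xs \<subseteq> A - {x}"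
    using xs S x by auto
  have red: "of_real (point_prob P x b) * pfaffian (length xs) (kernel_matrix (reduce_at P x b) xs)
      = complex_of_real (point_prob P x b * corr (reduce_at P x b) S)" for b
  proof (cases "point_prob P x b = 0")
    case False
    then show ?thesis
      using pfaffian_eq_corr[OF reduce_at_Gr[OF P x False] xs(1) xs_A(2)] xs by simp
  qed simp
  have big: "pfaffian (Suc (length xs)) (kernel_matrix P (x # xs)) = of_real (corr P (insert x S))"
    using pfaffian_eq_corr[OF P x_xs] xs by simp
  have small: "pfaffian (length xs) (kernel_matrix P xs) = of_real (corr P S)"
    using pfaffian_eq_corr[OF P xs(1) xs_A(1)] xs by simp
  have "complex_of_real (corr P (insert x S)) = of_real (point_prob P x True * corr (reduce_at P x True) S)"
    using pfaffian_kernel_occupied[OF P x xs_A(2)] unfolding big red .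
  then show "corr P (insert x S) = point_prob P x True * corr (reduce_at P x True) S"
    by (simp only: of_real_eq_iff)
  have "complex_of_real (corr P S) - of_real (corr P (insert x S))
      = of_real (point_prob P x False * corr (reduce_at P x False) S)"
    using pfaffian_kernel_vacant[OF P x xs_A(2)] unfolding big small red .
  then show "corr P S - corr P (insert x S) = point_prob P x False * corr (reduce_at P x False) S"
    by (metis of_real_diff of_real_eq_iff)
qed

text \<open>
  Prescribing the state of \<open>x\<close> first and the remaining states afterwards: termwise application of the
  corresponding identities for correlations.
\<close>

lemma cyl_weight_one_point:
  assumes P: "P \<in> Gr A" and x: "x \<in> A"
    and YZ: "finite Y" "finite Z" "Y \<subseteq> A - {x}" "Z \<subseteq> A - {x}"
  shows cyl_weight_occupied:
      "cyl_weight (corr P) (insert x Y) Z = point_prob P x True * cyl_weight (corr (reduce_at P x True)) Y Z"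
    and cyl_weight_vacant:
      "cyl_weight (corr P) Y (insert x Z) = point_prob P x False * cyl_weight (corr (reduce_at P x False)) Y Z"
proof -
  have YW: "finite (Y \<union> W)" "Y \<union> W \<subseteq> A - {x}" if "W \<in> Pow Z" for W
    using that YZ by (auto dest: finite_subset)
  show "cyl_weight (corr P) (insert x Y) Z = point_prob P x True * cyl_weight (corr (reduce_at P x True)) Y Z"
    unfolding cyl_weight_def sum_distrib_left
    by (intro sum.cong refl) (simp add: corr_insert[OF P x YW])
  have "x \<notin> Z"
    using YZ by auto
  then show "cyl_weight (corr P) Y (insert x Z) = point_prob P x False * cyl_weight (corr (reduce_at P x False)) Y Z"
    unfolding cyl_weight_insert_alt[OF YZ(2) \<open>x \<notin> Z\<close>] unfolding cyl_weight_def sum_distrib_left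
    by (intro sum.cong refl) (simp add: corr_diff[OF P x YW])
qed

text \<open>
  If the point has probability \<open>0\<close> for the prescribed state, so has the cylinder; otherwise
  the reduced projection takes over on a smaller set.
\<close>

lemma cyl_weight_nonneg:
  assumes "finite U" "P \<in> Gr A" "Y \<union> Z = U" "Y \<inter> Z = {}" "U \<subseteq> A"
  shows "0 \<le> cyl_weight (corr P) Y Z"
  using assms
proof (induction U arbitrary: A P Y Z)
  case empty
  then show ?case by simp
next
  case (insert x U)
  have x: "x \<in> A" and P: "P \<in> Gr A" and fin: "finite Y" "finite Z"
    using insert.prems insert.hyps by (auto intro: finite_subset[of _ "insert x U"])
  have sub: "Y - {x} \<subseteq> A - {x}" "Z - {x} \<subseteq> A - {x}"
    using insert.prems by auto
  have IH: "0 \<le> point_prob P x b * cyl_weight (corr (reduce_at P x b)) (Y - {x}) (Z - {x})" for b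
  proof (cases "point_prob P x b = 0")
    case False
    have "0 \<le> cyl_weight (corr (reduce_at P x b)) (Y - {x}) (Z - {x})"
      by (rule insert.IH[OF reduce_at_Gr[OF P x False]]) (use insert.prems insert.hyps in auto)
    then show ?thesis
      using point_prob_nonneg[OF P x] by simp
  qed simp
  have "x \<in> Y \<or> x \<in> Z"
    using insert.prems by auto
  then show ?case
  proof
    assume "x \<in> Y"
    then have "Y = insert x (Y - {x})" "Z = Z - {x}"
      using insert.prems by auto
    then show ?thesis
      using cyl_weight_occupied[OF P x _ _ sub] fin IH[of True] by (metis finite_Diff)
  next
    assume "x \<in> Z"
    then have "Z = insert x (Z - {x})" "Y = Y - {x}"
      using insert.prems by auto
    then show ?thesis
      using cyl_weight_vacant[OF P x _ _ sub] fin IH[of False] by (metis finite_Diff)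
  qed
qed


section \<open>Iterated reduction\<close>

text \<open>
  For finite \<open>X\<close> and \<open>X'\<close> this is \<open>\<K>\<^sub>X\<^sup>+ \<oplus> \<K>\<^sub>X\<^sub>'\<^sup>-\<close>, by \<open>KK_plus_KK_minus\<close>.
\<close>

definition supported :: "'a set \<Rightarrow> 'a set \<Rightarrow> 'a dvec set" where
  "supported X X' = {v. (\<forall>y. y \<notin> X \<longrightarrow> fst v y = 0) \<and> (\<forall>y. y \<notin> X' \<longrightarrow> snd v y = 0)}"

lemma supported_decompose:
  assumes "x \<in> (if b then X else X')" "x \<notin> (if b then X' else X)" "v \<in> supported X X'"
  shows "\<exists>w\<in>supported (X - {x}) (X' - {x}). \<exists>c. v = KK_scale c (ket x b) + w"
proof -
  let ?c = "if b then fst v x else snd v x"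
  have "v - KK_scale ?c (ket x b) \<in> supported (X - {x}) (X' - {x})"
    using assms by (auto simp: supported_def KK_scale_def ket_def unit_vec_def split: if_splits)
  moreover have "v = KK_scale ?c (ket x b) + (v - KK_scale ?c (ket x b))"
    by simp
  ultimately show ?thesis
    by blast
qed

lemma supported_ket: "x \<in> (if b then X else X') \<Longrightarrow> ket x b \<in> supported X X'"
  by (auto simp: supported_def ket_def unit_vec_def split: if_splits)

lemma supported_lincomb: "v \<in> supported X X' \<Longrightarrow> w \<in> supported X X' \<Longrightarrow> KK_scale c v + w \<in> supported X X'"
  by (auto simp: supported_def KK_scale_def)

lemma supported_mono: "X \<subseteq> Y \<Longrightarrow> X' \<subseteq> Y' \<Longrightarrow> supported X X' \<subseteq> supported Y Y'"
  unfolding supported_def by blast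

lemma supported_in_KK:
  assumes "finite X" "finite X'" "X \<union> X' \<subseteq> A" "v \<in> supported X X'"
  shows "v \<in> KK A"
proof -
  have "(\<lambda>x. (cmod (f x))\<^sup>2) summable_on UNIV"
    if "finite Y" "\<forall>y. y \<notin> Y \<longrightarrow> f y = 0" for Y :: "'a set" and f :: "'a \<Rightarrow> complex"
    by (rule finite_nonzero_values_imp_summable_on) (use that in \<open>auto intro: finite_subset[of _ Y]\<close>)
  then show ?thesis
    using assms by (auto simp: KK_iff supported_def)
qed

text \<open>
  Induction on the set of prescribed points. A point \<open>x\<close> of it has positive probability for its
  prescribed state, since \<open>d = 0\<close> would put \<open>ket x b\<close> into the range of \<open>P\<close>, against regularity. The
  reduced projection is regular for the remaining points: a vector \<open>p + c u\<close> of its range that lies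
  in the space of the remaining points has \<open>p = 0\<close> by regularity of \<open>P\<close>, and then \<open>c = 0\<close> as its
  coordinates at \<open>x\<close> vanish. The two steps of forming the range combine, because the vectors added
  in the later step already vanish at \<open>x\<close>.
\<close>

lemma iterated_reduction:
  assumes "finite U" "P \<in> Gr A" "X \<union> X' = U" "X \<inter> X' = {}" "U \<subseteq> A"
    and "P ` KK A \<inter> supported X X' = {0}"
  shows "\<exists>Q\<in>Gr (A - U). Q ` KK (A - U) = {p + v |p v. p \<in> P ` KK A \<and> v \<in> supported X X'} \<inter> KK (A - U)
     \<and> 0 < cyl_weight (corr P) X X'
     \<and> (\<forall>S. finite S \<and> S \<subseteq> A - U \<longrightarrow> cyl_weight (corr P) (X \<union> S) X' = cyl_weight (corr P) X X' * corr Q S)"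
  using assms
proof (induction U arbitrary: A P X X')
  case empty
  have "X = {}" "X' = {}"
    using empty.prems by auto
  moreover have "supported {} {} = {0 :: 'a dvec}"
    by (auto simp: supported_def prod_eq_iff fun_eq_iff)
  moreover have "P ` KK A \<subseteq> KK A"
    using Gr_closed[OF empty.prems(1)] by auto
  then have "{p + v |p v. p \<in> P ` KK A \<and> v \<in> {0}} \<inter> KK A = P ` KK A"
    by (simp add: Int_absorb2 del: split_paired_Ex)
  ultimately show ?case
    using empty.prems(1) by (intro bexI[of _ P]) (simp_all del: split_paired_Ex)
next
  case (insert x U)
  define b where "b = (x \<in> X)"
  define Y where "Y = X - {x}"
  define Y' where "Y' = X' - {x}"
  have P: "P \<in> Gr A" and x: "x \<in> A" and fin: "finite X" "finite X'"
    using insert.prems insert.hyps by (auto intro: finite_subset[of _ "insert x U"])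
  have x_mem: "x \<in> (if b then X else X')" "x \<notin> (if b then X' else X)"
    using insert.prems by (auto simp: b_def)
  have U: "Y \<union> Y' = U" "Y \<inter> Y' = {}" "U \<subseteq> A - {x}"
    using insert.prems insert.hyps by (auto simp: Y_def Y'_def)
  have finY: "finite Y" "finite Y'" and subY: "Y \<subseteq> A - {x}" "Y' \<subseteq> A - {x}"
    using fin U by (auto simp: Y_def Y'_def)
  have zero: "p = 0" if "p \<in> P ` KK A" "p \<in> supported X X'" for p
    using insert.prems(5) that by blast
  have prob_nz: "point_prob P x b \<noteq> 0"
  proof
    assume "point_prob P x b = 0"
    then have "P (ket x b) = ket x b"
      using point_prob_eq_0[OF P x] by blast
    then have "ket x b \<in> P ` KK A"
      using ket_in_KK[OF x] by (metis imageI)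
    then have "ket x b = 0"
      by (rule zero) (rule supported_ket[OF x_mem(1)])
    then show False
      using KK_inner_ket_ket[of x b x b] by (simp add: KK_inner_self)
  qed
  define R where "R = reduce_at P x b"
  have R: "R \<in> Gr (A - {x})"
    unfolding R_def by (rule reduce_at_Gr[OF P x prob_nz])
  have R_range: "R ` KK (A - {x}) = {p + KK_scale c (ket x b) |p c. p \<in> P ` KK A} \<inter> KK (A - {x})"
    unfolding R_def by (rule reduce_at_range[OF P x prob_nz])
  have Y_in: "supported Y Y' \<subseteq> supported X X'"
    by (rule supported_mono) (auto simp: Y_def Y'_def)
  have Y_KK: "w \<in> KK (A - {x})" if "w \<in> supported Y Y'" for w
    by (rule supported_in_KK[OF finY _ that]) (use subY in auto)
  have regR: "R ` KK (A - {x}) \<inter> supported Y Y' = {0}"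
  proof (intro equalityI subsetI)
    fix w assume w: "w \<in> R ` KK (A - {x}) \<inter> supported Y Y'"
    then obtain p c where p: "p \<in> P ` KK A" "w = p + KK_scale c (ket x b)"
      unfolding R_range by blast
    have "p = KK_scale (- c) (ket x b) + w"
      by (simp add: p(2) KK_scale_def prod_eq_iff fun_eq_iff)
    then have "p \<in> supported X X'"
      using supported_lincomb[OF supported_ket[OF x_mem(1)]] w Y_in by blast
    then have "w = KK_scale c (ket x b)"
      using zero[OF p(1)] p(2) by simp
    moreover have "KK_inner (ket x b) w = 0"
      using w by (auto simp: supported_def KK_inner_ket Y_def Y'_def)
    ultimately have "c = 0"
      by (simp add: KK_inner_scale_right KK_inner_ket_ket)
    then show "w \<in> {0}"
      using \<open>w = KK_scale c (ket x b)\<close> by (simp add: KK_scale_def prod_eq_iff fun_eq_iff)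
  next
    have "R 0 = 0"
      using Gr_scale[OF R KK_zero, of 0] by (simp add: KK_scale_def prod_eq_iff fun_eq_iff zero_prod_def zero_fun_def)
    then show "w \<in> R ` KK (A - {x}) \<inter> supported Y Y'" if "w \<in> {0}" for w
      using that KK_zero[of "A - {x}"] by (auto simp: supported_def intro!: image_eqI[of _ _ 0])
  qed
  obtain Q where Q: "Q \<in> Gr (A - {x} - U)"
    and Q_range: "Q ` KK (A - {x} - U)
        = {p + v |p v. p \<in> R ` KK (A - {x}) \<and> v \<in> supported Y Y'} \<inter> KK (A - {x} - U)"
    and Q_pos: "0 < cyl_weight (corr R) Y Y'"
    and Q_corr: "\<And>S. finite S \<Longrightarrow> S \<subseteq> A - {x} - U \<Longrightarrow>
        cyl_weight (corr R) (Y \<union> S) Y' = cyl_weight (corr R) Y Y' * corr Q S"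
    using insert.IH[OF R U regR] by (elim bexE conjE) (rule that, assumption+, blast)
  have A': "A - insert x U = A - {x} - U"
    by auto
  have weight: "cyl_weight (corr P) (X \<union> S) X' = point_prob P x b * cyl_weight (corr R) (Y \<union> S) Y'"
    if "finite S" "S \<subseteq> A - {x} - U" for S
  proof (cases b)
    case True
    then have "X \<union> S = insert x (Y \<union> S)" "X' = Y'"
      using x_mem by (auto simp: Y_def Y'_def)
    then show ?thesis
      using cyl_weight_occupied[OF P x, of "Y \<union> S" Y'] that finY subY True by (auto simp: R_def)
  next
    case False
    then have "X \<union> S = Y \<union> S" "X' = insert x Y'"
      using x_mem by (auto simp: Y_def Y'_def)
    then show ?thesis
      using cyl_weight_vacant[OF P x, of "Y \<union> S" Y'] that finY subY False by (auto simp: R_def)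
  qed
  have weight0: "cyl_weight (corr P) X X' = point_prob P x b * cyl_weight (corr R) Y Y'"
    using weight[of "{}"] by simp
  have range: "{p + v |p v. p \<in> R ` KK (A - {x}) \<and> v \<in> supported Y Y'} \<inter> KK (A - {x} - U)
      = {p + v |p v. p \<in> P ` KK A \<and> v \<in> supported X X'} \<inter> KK (A - {x} - U)"
  proof (intro equalityI subsetI IntI; (elim IntE)?)
    fix z assume "z \<in> {p + v |p v. p \<in> R ` KK (A - {x}) \<and> v \<in> supported Y Y'}"
    then obtain p c v where "p \<in> P ` KK A" "v \<in> supported Y Y'" "z = p + KK_scale c (ket x b) + v"
      unfolding R_range by blast
    moreover from this have "KK_scale c (ket x b) + v \<in> supported X X'"
      using supported_lincomb[OF supported_ket[OF x_mem(1)]] Y_in by blast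
    ultimately show "z \<in> {p + v |p v. p \<in> P ` KK A \<and> v \<in> supported X X'}"
      unfolding add.assoc by blast
  next
    fix z assume "z \<in> {p + v |p v. p \<in> P ` KK A \<and> v \<in> supported X X'}" and z: "z \<in> KK (A - {x} - U)"
    then obtain p v where p: "p \<in> P ` KK A" "v \<in> supported X X'" "z = p + v"
      by blast
    obtain w c where w: "w \<in> supported Y Y'" "v = KK_scale c (ket x b) + w"
      using supported_decompose[OF x_mem p(2)] by (auto simp: Y_def Y'_def)
    have z': "z \<in> KK (A - {x})"
      using z KK_mono[of "A - {x} - U" "A - {x}"] by auto
    have eq: "p + KK_scale c (ket x b) = z - w"
      by (simp add: p(3) w(2))
    have "p + KK_scale c (ket x b) \<in> KK (A - {x})"
      unfolding eq by (intro KK_diff z' Y_KK w)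
    then have "p + KK_scale c (ket x b) \<in> R ` KK (A - {x})"
      unfolding R_range using p(1) by blast
    moreover have "z = p + KK_scale c (ket x b) + w"
      by (simp add: eq)
    ultimately show "z \<in> {p + v |p v. p \<in> R ` KK (A - {x}) \<and> v \<in> supported Y Y'}"
      using w(1) by blast
  qed auto
  have "0 < point_prob P x b"
    using point_prob_nonneg[OF P x, of b] prob_nz by simp
  then have "0 < cyl_weight (corr P) X X'"
    using Q_pos by (simp add: weight0)
  moreover have "cyl_weight (corr P) (X \<union> S) X' = cyl_weight (corr P) X X' * corr Q S"
    if "finite S" "S \<subseteq> A - {x} - U" for S
    by (simp add: weight[OF that] weight0 Q_corr[OF that])
  ultimately show ?case
    unfolding A' using Q Q_range range by (intro bexI[of _ Q]) auto
qed


section \<open>Coordinate subspaces as closed spans\<close>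

lemma supported_in_span_ket:
  assumes "finite X" "v \<in> (if b then supported X {} else supported {} X)"
  shows "v \<in> KK_span {ket x b |x. x \<in> X}"
  using assms
proof (induction X arbitrary: v)
  case empty
  then have "v = 0"
    by (auto simp: supported_def prod_eq_iff fun_eq_iff split: if_splits)
  then show ?case
    by (simp add: KK.span_zero)
next
  case (insert x X)
  have "\<exists>w\<in>(if b then supported X {} else supported {} X). \<exists>c. v = KK_scale c (ket x b) + w"
  proof (cases b)
    case True
    then show ?thesis
      using supported_decompose[of x True "insert x X" "{}" v] insert.prems insert.hyps by simp
  next
    case False
    then show ?thesis
      using supported_decompose[of x False "{}" "insert x X" v] insert.prems insert.hyps by simp
  qed
  then obtain w c where w: "w \<in> (if b then supported X {} else supported {} X)" "v = KK_scale c (ket x b) + w"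
    by blast
  have "w \<in> KK_span {ket y b |y. y \<in> insert x X}"
    using KK.span_mono[of "{ket y b |y. y \<in> X}" "{ket y b |y. y \<in> insert x X}"] insert.IH[OF w(1)] by blast
  then show ?case
    unfolding w(2) by (rule KK.span_add[OF KK.span_scale[OF KK.span_base], rotated]) auto
qed

lemma cmod_KK_inner_ket_le:
  assumes "v \<in> KK A"
  shows "cmod (KK_inner (ket x b) v) \<le> KK_norm v"
  using cmod_coord_le_KK_inner_self[OF assms, of x]
  unfolding KK_norm_def KK_inner_ket by (auto intro: real_le_rsqrt)

text \<open>
  Coordinates are continuous, so vectors in the closure have the same vanishing coordinates; a
  vector with finitely many admissible coordinates is already a finite combination.
\<close>

lemma KK_closed_span_ket:
  assumes "finite X"
  shows "KK_closed_span {ket x b |x. x \<in> X} = (if b then supported X {} else supported {} X)"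
proof -
  let ?S = "if b then supported X {} else supported {} X"
  have S_KK: "w \<in> KK UNIV" if "w \<in> ?S" for w
    using supported_in_KK[of X "{}" UNIV w] supported_in_KK[of "{}" X UNIV w] assms that
    by (auto split: if_splits)
  have "KK.subspace ?S"
    by (auto simp: KK.subspace_def supported_def KK_scale_def)
  moreover have "{ket x b |x. x \<in> X} \<subseteq> ?S"
    by (auto simp: supported_def ket_def unit_vec_def)
  ultimately have span: "KK_span {ket x b |x. x \<in> X} \<subseteq> ?S"
    by (intro KK.span_minimal)
  have "v \<in> ?S" if v: "v \<in> KK_closed_span {ket x b |x. x \<in> X}" for v
  proof -
    have coord: "KK_inner (ket y c) v = 0" if zero: "\<And>u. u \<in> ?S \<Longrightarrow> KK_inner (ket y c) u = 0" for y c
    proof -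
      have "cmod (KK_inner (ket y c) v) = 0"
      proof (rule dense_eq0_I)
      fix \<epsilon> :: real assume "0 < \<epsilon>"
      then obtain u where u: "u \<in> ?S" "KK_norm (v - u) < \<epsilon>"
        using v span unfolding KK_closed_span_def by blast
      have "v - u \<in> KK UNIV"
        using v S_KK[OF u(1)] by (intro KK_diff) (auto simp: KK_closed_span_def)
      from cmod_KK_inner_ket_le[OF this, of y c] show "\<bar>cmod (KK_inner (ket y c) v)\<bar> \<le> \<epsilon>"
        using u(2) zero[OF u(1)] by (simp add: KK_inner_ket_diff)
      qed
      then show ?thesis
        by simp
    qed
    have "KK_inner (ket y c) v = 0" if "c \<noteq> b \<or> y \<notin> X" for y c
      by (rule coord) (use that in \<open>auto simp: KK_inner_ket supported_def split: if_splits\<close>)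
    from this[of True] this[of False] show ?thesis
      by (auto simp: KK_inner_ket supported_def)
  qed
  moreover have "v \<in> KK_closed_span {ket x b |x. x \<in> X}" if v: "v \<in> ?S" for v
    unfolding KK_closed_span_def
    using S_KK[OF v] supported_in_span_ket[OF assms v]
    by (auto simp: KK_norm_def KK_inner_self intro!: bexI[of _ v])
  ultimately show ?thesis
    by blast
qed

lemma KK_plus_KK_minus:
  assumes "finite X" "finite X'"
  shows "KK_plus X + KK_minus X' = supported X X'"
proof -
  have "KK_plus X = supported X {}"
    using KK_closed_span_ket[OF assms(1), of True] by (simp add: KK_plus_def ket_def)
  moreover have "KK_minus X' = supported {} X'"
    using KK_closed_span_ket[OF assms(2), of False] by (simp add: KK_minus_def ket_def)
  moreover have "supported X {} + supported {} X' = supported X X'"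
  proof (intro equalityI subsetI)
    fix v assume v: "v \<in> supported X X'"
    have "(fst v, 0) \<in> supported X {}" "(0, snd v) \<in> supported {} X'" "v = (fst v, 0) + (0, snd v)"
      using v by (auto simp: supported_def prod_eq_iff)
    then show "v \<in> supported X {} + supported {} X'"
      unfolding set_plus_def by blast
  qed (auto simp: set_plus_def supported_def)
  ultimately show ?thesis
    by simp
qed

text \<open>
  Two vectors of the range with the required property differ by a vector of the range that is
  orthogonal to the range, and hence to itself.
\<close>

lemma orth_projection_onto_range:
  assumes Q: "Q \<in> Gr A" and v: "v \<in> KK A"
  shows "orth_projection_onto (Q ` KK A) v = Q v"
  unfolding orth_projection_onto_def
proof (rule the_equality)
  have orth: "KK_inner (Q u) (v - Q v) = 0" if "u \<in> KK A" for u
    using that v by (simp add: KK_inner_diff_right[where A = A] Gr_closed[OF Q] Gr_idem[OF Q] Gr_sym[OF Q])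
  then show "Q v \<in> Q ` KK A \<and> (\<forall>u\<in>Q ` KK A. KK_inner u (v - Q v) = 0)"
    using v by auto
  fix w assume w: "w \<in> Q ` KK A \<and> (\<forall>u\<in>Q ` KK A. KK_inner u (v - w) = 0)"
  then obtain t where t: "t \<in> KK A" "w = Q t"
    by auto
  have Qvt: "Q v - w = Q (v - t)" and vt: "v - t \<in> KK A"
    using t v by (auto simp: Gr_diff[OF Q] KK_diff)
  let ?u = "Q v - w"
  have u: "?u \<in> KK A" "?u \<in> Q ` KK A"
    unfolding Qvt using vt Gr_closed[OF Q] by auto
  have "KK_inner ?u (v - w) = 0" "KK_inner ?u (v - Q v) = 0"
    using w u orth[OF vt] Qvt by auto
  then have "KK_inner ?u ?u = 0"
    using u v t by (simp add: KK_inner_diff_right[where A = A] Gr_closed[OF Q])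
  then have "?u = 0"
    using KK_inner_self_eq_0_iff[OF u(1)] by simp
  then show "w = Q v"
    by simp
qed


section \<open>Pfaffian processes and their conditional measures\<close>

lemma is_pfaffian_process_iff_corr:
  assumes "P \<in> Gr A"
  shows "is_pfaffian_process A P M \<longleftrightarrow> prob_space M \<and> sets M = sets (Omega A) \<and>
     (\<forall>F. finite F \<and> F \<subseteq> A \<longrightarrow> measure M (cylinder A F {}) = corr P F)"
proof -
  have event: "{\<omega> \<in> Pow A. \<forall>x\<in>F. x \<in> \<omega>} = cylinder A F {}" for F
    by (auto simp: cylinder_def)
  have "(\<forall>xs. distinct xs \<and> set xs \<subseteq> A \<longrightarrow>
        complex_of_real (measure M {\<omega> \<in> Pow A. \<forall>x\<in>set xs. x \<in> \<omega>}) = pfaffian (length xs) (kernel_matrix P xs))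
     \<longleftrightarrow> (\<forall>xs. distinct xs \<and> set xs \<subseteq> A \<longrightarrow> measure M (cylinder A (set xs) {}) = corr P (set xs))"
    unfolding event using pfaffian_eq_corr[OF assms] by (metis of_real_eq_iff)
  also have "\<dots> \<longleftrightarrow> (\<forall>F. finite F \<and> F \<subseteq> A \<longrightarrow> measure M (cylinder A F {}) = corr P F)"
    by (metis List.finite_set finite_distinct_list)
  finally show ?thesis
    unfolding is_pfaffian_process_def using sets_eq_imp_space_eq[of M "Omega A"] by auto
qed

lemma is_pfaffian_process_unique:
  assumes A: "countable A" and P: "P \<in> Gr A"
    and M: "is_pfaffian_process A P M" and N: "is_pfaffian_process A P N"
  shows "M = N"
proof (rule Omega_measure_eqI[OF A])
  fix F assume F: "finite F" "F \<subseteq> A"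
  interpret M: prob_space M
    using M by (simp add: is_pfaffian_process_def)
  interpret N: prob_space N
    using N by (simp add: is_pfaffian_process_def)
  show "emeasure M (cylinder A F {}) = emeasure N (cylinder A F {})"
    using M N F by (simp add: is_pfaffian_process_iff_corr[OF P] M.emeasure_eq_measure N.emeasure_eq_measure)
qed (use M N in \<open>auto simp: is_pfaffian_process_def\<close>)

lemma pfaffian_process_eqI:
  assumes "countable A" "P \<in> Gr A" "is_pfaffian_process A P M"
  shows "pfaffian_process A P = M"
  unfolding pfaffian_process_def
  using assms is_pfaffian_process_unique by (intro the_equality) blast+

lemma is_pfaffian_process_pfaffian_process:
  assumes A: "countable A" and P: "P \<in> Gr A"
  shows "is_pfaffian_process A P (pfaffian_process A P)"
proof -
  have "\<exists>M. prob_space M \<and> sets M = sets (Omega A) \<and>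
      (\<forall>F. finite F \<and> F \<subseteq> A \<longrightarrow> measure M (cylinder A F {}) = corr P F)"
    by (rule ex_measure_with_correlations[OF A]) (auto intro: cyl_weight_nonneg[OF _ P refl])
  then obtain M where "is_pfaffian_process A P M"
    using is_pfaffian_process_iff_corr[OF P] by blast
  then show ?thesis
    using pfaffian_process_eqI[OF A P] by metis
qed

lemma emeasure_cylinder_eq_cyl_weight:
  assumes A: "countable A" and P: "P \<in> Gr A" and M: "is_pfaffian_process A P M"
    and "finite Z" "finite Y" "Y \<subseteq> A" "Z \<subseteq> A"
  shows "emeasure M (cylinder A Y Z) = ennreal (cyl_weight (corr P) Y Z)"
proof -
  interpret prob_space M
    using M by (simp add: is_pfaffian_process_def)
  have sets: "sets M = sets (Omega A)"
    using M by (simp add: is_pfaffian_process_def)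
  have "measure M (cylinder A Y Z) = cyl_weight (corr P) Y Z"
    using assms(4-)
  proof (induction Z arbitrary: Y)
    case empty
    then show ?case
      using M by (simp add: is_pfaffian_process_iff_corr[OF P])
  next
    case (insert z Z)
    have "measure M (cylinder A Y (insert z Z)) = measure M (cylinder A Y Z) - measure M (cylinder A (insert z Y) Z)"
      unfolding cylinder_split
    proof (rule finite_measure_Diff)
      show "cylinder A Y Z \<in> events" "cylinder A (insert z Y) Z \<in> events"
        using insert.prems insert.hyps unfolding sets by (auto intro!: cylinder_in_sets_Omega[OF A])
      show "cylinder A (insert z Y) Z \<subseteq> cylinder A Y Z"
        by (auto simp: cylinder_def)
    qed
    then show ?case
      using insert by (simp add: cyl_weight_insert)
  qed
  then show ?thesis
    by (simp add: emeasure_eq_measure)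
qed

text \<open>
  The kernel evaluates the operator on basis vectors only. This allows the passage between operators
  that agree on \<open>KK A\<close> but differ on the ambient type, as the reduced projection and the operator
  found by iteration may do.
\<close>

lemma is_pfaffian_process_cong:
  assumes "\<And>v. v \<in> KK A \<Longrightarrow> P v = Q v"
  shows "is_pfaffian_process A P M \<longleftrightarrow> is_pfaffian_process A Q M"
proof -
  have "pfaffian (length xs) (kernel_matrix P xs) = pfaffian (length xs) (kernel_matrix Q xs)"
    if xs: "set xs \<subseteq> A" for xs
  proof (rule pfaffian_cong)
    fix i j assume "i < 2 * length xs" "j < 2 * length xs"
    then have "xs ! (j div 2) \<in> A"
      using xs by (auto intro!: subsetD[OF xs] nth_mem)
    then show "kernel_matrix P xs i j = kernel_matrix Q xs i j"
      by (simp add: kernel_matrix_eq_entry kernel_entry_def assms ket_in_KK)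
  qed
  then show ?thesis
    unfolding is_pfaffian_process_def by auto
qed

text \<open>
  Under \<open>\<omega> \<mapsto> \<omega> - X\<close> the event \<open>S \<subseteq> \<omega>\<close> on the smaller set pulls back to the cylinder
  \<open>C(X \<union> S, X')\<close>, so conditioning divides its probability by that of \<open>C(X, X')\<close>.
\<close>

lemma is_pfaffian_process_conditional:
  assumes A: "countable A" and M: "prob_space M" "sets M = sets (Omega A)"
    and fin: "finite X" "finite X'" and sub: "X \<subseteq> A" "X' \<subseteq> A"
    and Q: "Q \<in> Gr (A - (X \<union> X'))"
    and weight: "0 < w" "\<And>S. finite S \<Longrightarrow> S \<subseteq> A - (X \<union> X') \<Longrightarrow>
        emeasure M (cylinder A (X \<union> S) X') = ennreal (w * corr Q S)"
  shows "is_pfaffian_process (A - (X \<union> X')) Q (conditional_measure A M X X')"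
proof -
  interpret prob_space M by fact
  define B where "B = A - (X \<union> X')"
  define C where "C = cylinder A X X'"
  define N where "N = scale_measure (inverse (emeasure M C)) (restrict_space M C)"
  have B: "countable B"
    unfolding B_def using A by (rule countable_Diff)
  have C_sets: "C \<in> sets M"
    unfolding C_def M(2) by (rule cylinder_in_sets_Omega[OF A fin sub])
  have C_weight: "emeasure M C = ennreal w"
    using weight(2)[of "{}"] by (simp add: C_def)
  have space_M: "space M = Pow A"
    using sets_eq_imp_space_eq[OF M(2)] by simp
  have space_N: "space N = C"
    using sets.sets_into_space[OF C_sets]
    by (auto simp: N_def space_scale_measure space_restrict_space)
  have sets_N: "sets N = sets (restrict_space M C)"
    by (simp add: N_def)
  have preimage: "{\<omega> \<in> C. S \<subseteq> \<omega> - X} = cylinder A (X \<union> S) X'" if "S \<subseteq> B" for S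
    using that by (auto simp: C_def cylinder_def B_def)
  have cyl_N: "cylinder A (X \<union> S) X' \<in> sets N" if "finite S" "S \<subseteq> B" for S
  proof -
    have "cylinder A (X \<union> S) X' \<in> sets M"
      unfolding M(2) using that fin sub by (intro cylinder_in_sets_Omega[OF A]) (auto simp: B_def)
    moreover have "cylinder A (X \<union> S) X' \<subseteq> C"
      by (auto simp: C_def cylinder_def)
    ultimately show ?thesis
      unfolding sets_N using C_sets by (simp add: sets_restrict_space_iff)
  qed
  have meas: "(\<lambda>\<omega>. \<omega> - X) \<in> measurable N (Omega B)"
  proof (rule measurable_into_Omega[OF B])
    show "(\<lambda>\<omega>. \<omega> - X) \<in> space N \<rightarrow> Pow B"
      by (auto simp: space_N C_def cylinder_def B_def)
    show "{\<omega> \<in> space N. S \<subseteq> \<omega> - X} \<in> sets N" if "finite S" "S \<subseteq> B" for S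
      unfolding space_N preimage[OF that(2)] by (rule cyl_N[OF that])
  qed
  have cond: "conditional_measure A M X X' = distr N (Omega B) (\<lambda>\<omega>. \<omega> - X)"
    by (simp add: conditional_measure_def N_def B_def C_def)
  have emeasure_cond: "emeasure (distr N (Omega B) (\<lambda>\<omega>. \<omega> - X)) (cylinder B S {}) = ennreal (corr Q S)"
    if S: "finite S" "S \<subseteq> B" for S
  proof -
    have "emeasure (distr N (Omega B) (\<lambda>\<omega>. \<omega> - X)) (cylinder B S {})
        = emeasure N ((\<lambda>\<omega>. \<omega> - X) -` cylinder B S {} \<inter> space N)"
      by (rule emeasure_distr[OF meas]) (use S in \<open>auto intro: cylinder_in_sets_Omega[OF B]\<close>)
    also have "(\<lambda>\<omega>. \<omega> - X) -` cylinder B S {} \<inter> space N = {\<omega> \<in> C. S \<subseteq> \<omega> - X}"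
      by (auto simp: space_N C_def cylinder_def B_def)
    also have "\<dots> = cylinder A (X \<union> S) X'"
      by (rule preimage[OF S(2)])
    also have "emeasure N \<dots> = inverse (ennreal w) * emeasure (restrict_space M C) (cylinder A (X \<union> S) X')"
      by (simp add: N_def C_weight)
    also have "emeasure (restrict_space M C) (cylinder A (X \<union> S) X') = emeasure M (cylinder A (X \<union> S) X')"
      using C_sets by (intro emeasure_restrict_space) (auto simp: C_def cylinder_def)
    also have "\<dots> = ennreal (w * corr Q S)"
      by (rule weight(2)[OF S[unfolded B_def]])
    also have "inverse (ennreal w) * ennreal (w * corr Q S) = ennreal (inverse w) * ennreal (w * corr Q S)"
      using weight(1) by (simp add: inverse_ennreal)
    also have "\<dots> = ennreal (corr Q S)"
      using weight(1) by (subst ennreal_mult'[symmetric]) (simp_all add: mult.assoc[symmetric])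
    finally show ?thesis .
  qed
  have corr_nonneg: "0 \<le> corr Q S" if "finite S" "S \<subseteq> B" for S
    using cyl_weight_nonneg[OF that(1) Q, of S "{}"] that by (simp add: B_def)
  have "prob_space (distr N (Omega B) (\<lambda>\<omega>. \<omega> - X))"
  proof
    have "space (distr N (Omega B) (\<lambda>\<omega>. \<omega> - X)) = cylinder B {} {}"
      by (auto simp: cylinder_def)
    then show "emeasure (distr N (Omega B) (\<lambda>\<omega>. \<omega> - X)) (space (distr N (Omega B) (\<lambda>\<omega>. \<omega> - X))) = 1"
      by (simp only: emeasure_cond finite.emptyI empty_subsetI corr_empty ennreal_1)
  qed
  then show ?thesis
    unfolding is_pfaffian_process_iff_corr[OF Q] unfolding cond B_def[symmetric]
    by (simp add: measure_def emeasure_cond corr_nonneg)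
qed

theorem theorem1p17:
  fixes \<XX> X X' :: "'a set"
    and P :: "'a dvec \<Rightarrow> 'a dvec"
  assumes "countable \<XX>"
    and "finite X" and "X \<subseteq> \<XX>"
    and "finite X'" and "X' \<subseteq> \<XX>"
    and "X \<inter> X' = {}"
    and "P \<in> Gr \<XX>"
    and "regular \<XX> P X X'"
  shows "emeasure (pfaffian_process \<XX> P) (cylinder \<XX> X X') > 0 \<and>
    conditional_measure \<XX> (pfaffian_process \<XX> P) X X'
      = pfaffian_process (\<XX> - (X \<union> X')) (reduced_projection \<XX> P X X') \<and>
    (\<exists>Q\<in>Gr (\<XX> - (X \<union> X')).
       is_pfaffian_process (\<XX> - (X \<union> X')) Q
         (conditional_measure \<XX> (pfaffian_process \<XX> P) X X'))"
proof -
  let ?B = "\<XX> - (X \<union> X')" and ?M = "pfaffian_process \<XX> P" and ?w = "cyl_weight (corr P) X X'"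
  note fin = assms(2,4) and sub = assms(3,5) and P = assms(7)
  have V: "KK_plus X + KK_minus X' = supported X X'"
    by (rule KK_plus_KK_minus[OF fin])
  obtain Q where Q: "Q \<in> Gr ?B"
    and range: "Q ` KK ?B = {p + v |p v. p \<in> P ` KK \<XX> \<and> v \<in> supported X X'} \<inter> KK ?B"
    and pos: "0 < ?w"
    and weight: "\<And>S. finite S \<Longrightarrow> S \<subseteq> ?B \<Longrightarrow> cyl_weight (corr P) (X \<union> S) X' = ?w * corr Q S"
  proof -
    have "X \<union> X' \<subseteq> \<XX>" "P ` KK \<XX> \<inter> supported X X' = {0}"
      using sub assms(8) by (auto simp only: regular_def V Un_subset_iff)
    from iterated_reduction[OF finite_UnI[OF fin] P refl assms(6) this] show thesis
      by (elim bexE conjE) (rule that, assumption+, blast)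
  qed
  have M: "is_pfaffian_process \<XX> P ?M"
    by (rule is_pfaffian_process_pfaffian_process[OF assms(1) P])
  have M_cyl: "emeasure ?M (cylinder \<XX> (X \<union> S) X') = ennreal (?w * corr Q S)" if "finite S" "S \<subseteq> ?B" for S
    using emeasure_cylinder_eq_cyl_weight[OF assms(1) P M fin(2), of "X \<union> S"] weight[OF that] that fin sub
    by auto
  have cond: "is_pfaffian_process ?B Q (conditional_measure \<XX> ?M X X')"
    using M by (intro is_pfaffian_process_conditional[OF assms(1) _ _ fin sub Q pos M_cyl])
      (auto simp: is_pfaffian_process_def)
  have "P ` KK \<XX> + (KK_plus X + KK_minus X') = {p + v |p v. p \<in> P ` KK \<XX> \<and> v \<in> supported X X'}"
    unfolding V unfolding set_plus_def by blast
  then have "reduced_projection \<XX> P X X' = orth_projection_onto (Q ` KK ?B)"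
    unfolding reduced_projection_def range by simp
  then have "reduced_projection \<XX> P X X' v = Q v" if "v \<in> KK ?B" for v
    using orth_projection_onto_range[OF Q that] by simp
  then have "pfaffian_process ?B (reduced_projection \<XX> P X X') = pfaffian_process ?B Q"
    unfolding pfaffian_process_def by (intro arg_cong[of _ _ The] ext is_pfaffian_process_cong)
  also have "\<dots> = conditional_measure \<XX> ?M X X'"
    by (rule pfaffian_process_eqI[OF _ Q cond]) (use assms(1) in auto)
  finally show ?thesis
    using cond Q M_cyl[of "{}"] pos by auto
qed

end
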